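(* Let $0 < k_1 < \cdots < k_r < n$ be integers. (1) Let $m$ be a positive integer. If there exist two indices $1 \leq i < j \leq r$ and an integer $t \geq 1$ such that $k_j = n - t k_i$ and $m \geq \max(4, t+2)$, then the diagonal action of $\mathbb{P}GL(n)$ on $F(k_1, \dots, k_r; n)^m$ is sparse. (2) If there exist three indices $1 \leq h < i < j \leq r$ such that $2k_h + k_i + k_j = 2n$, then the diagonal action of $\mathbb{P}GL(n)$ on $F(k_1, \dots, k_r; n)^3$ is sparse.
   Context: Work over an algebraically closed field. For integers $0 < k_1 < \cdots < k_r < n$ and an $n$-dimensional vector space $V$, $F(k_1, \dots, k_r; n)$ denotes the partial flag variety parameterizing flags $W_{k_1} \subset \cdots \subset W_{k_r} \subset V$ of linear subspaces with $\dim W_{k_i} = k_i$. The group $\mathbb{P}GL(n) = \mathbb{P}GL(V)$ acts on $F(k_1,\dots,k_r;n)$ and hence diagonally on the $m$-fold self-product $F(k_1,\dots,k_r;n)^m$. The action is called dense if it has a (Zariski) dense orbit, and sparse otherwise. *)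

theory Defs
  imports "HOL-Analysis.Analysis" "HOL-Algebra.Group_Action"
begin

section \<open>The group PGL(n)\<close>

text \<open>The ambient vector space is \<open>V = 'a ^ 'n\<close>, of dimension \<open>CARD('n)\<close>; its subspaces and their
  dimensions are expressed by \<open>vec.subspace\<close> and \<open>vec.dim\<close>.\<close>

definition GL :: "('a::field ^ 'n ^ 'n) monoid"
  where "GL = \<lparr>carrier = {A. invertible A}, mult = (**), one = mat 1\<rparr>"

definition scalar_matrices :: "('a::field ^ 'n ^ 'n) set"
  where "scalar_matrices = {mat c | c. c \<noteq> 0}"

definition PGL :: "('a::field ^ 'n ^ 'n) set monoid"
  where "PGL = GL Mod scalar_matrices"

lemma mat_mult_left: "(mat c ** A) $ i $ j = c * (A $ i $ j :: 'a::field)"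
proof -
  have "(mat c ** A) $ i $ j = (\<Sum>k\<in>UNIV. if k = i then c * A $ k $ j else 0)"
    unfolding matrix_matrix_mult_def mat_def vec_lambda_beta by (rule sum.cong) auto
  then show ?thesis by simp
qed

lemma mat_mult_right: "(A ** mat c) $ i $ j = (A $ i $ j :: 'a::field) * c"
proof -
  have "(A ** mat c) $ i $ j = (\<Sum>k\<in>UNIV. if k = j then A $ i $ k * c else 0)"
    unfolding matrix_matrix_mult_def mat_def vec_lambda_beta by (rule sum.cong) auto
  then show ?thesis by simp
qed

lemma mat_mult_mat: "mat c ** mat d = (mat (c * d) :: 'a::field ^ 'n ^ 'n)"
  by (simp add: vec_eq_iff mat_mult_left) (simp add: mat_def)

lemma mat_mult_commute: "A ** mat c = mat c ** (A :: 'a::field ^ 'n ^ 'n)"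
  by (simp add: vec_eq_iff mat_mult_left mat_mult_right)

lemma group_GL: "group (GL :: ('a::field ^ 'n ^ 'n) monoid)"
proof (rule groupI)
  fix A :: "'a ^ 'n ^ 'n"
  assume "A \<in> carrier GL"
  then obtain B where "A ** B = mat 1" "B ** A = mat 1"
    by (auto simp: GL_def invertible_def)
  then show "\<exists>B\<in>carrier GL. B \<otimes>\<^bsub>GL\<^esub> A = \<one>\<^bsub>GL\<^esub>"
    by (auto simp: GL_def invertible_def)
next
  show "\<one>\<^bsub>GL\<^esub> \<in> carrier (GL :: ('a ^ 'n ^ 'n) monoid)"
    by (auto simp: GL_def invertible_def intro!: exI[of _ "mat 1"])
qed (auto simp: GL_def invertible_mult matrix_mul_assoc)

lemma scalar_matrices_normal: "scalar_matrices \<lhd> (GL :: ('a::field ^ 'n ^ 'n) monoid)"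
proof -
  interpret group "GL :: ('a ^ 'n ^ 'n) monoid"
    by (rule group_GL)
  have inv: "mat d ** mat c = (mat 1 :: 'a ^ 'n ^ 'n)" "mat c ** mat d = (mat 1 :: 'a ^ 'n ^ 'n)"
    if "c \<noteq> 0" "d = inverse c" for c d :: 'a
    using that by (simp_all add: mat_mult_mat)
  have carr: "mat c \<in> carrier (GL :: ('a ^ 'n ^ 'n) monoid)" if "c \<noteq> 0" for c
    using inv[OF that refl] by (auto simp: GL_def invertible_def)
  have "subgroup scalar_matrices (GL :: ('a ^ 'n ^ 'n) monoid)"
  proof (rule subgroupI)
    show "scalar_matrices \<subseteq> carrier (GL :: ('a ^ 'n ^ 'n) monoid)"
      using carr by (auto simp: scalar_matrices_def)
    show "(scalar_matrices :: ('a ^ 'n ^ 'n) set) \<noteq> {}"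
      by (auto simp: scalar_matrices_def intro!: exI[of _ 1])
  next
    fix A :: "'a ^ 'n ^ 'n"
    assume "A \<in> scalar_matrices"
    then obtain c where c: "A = mat c" "c \<noteq> 0"
      by (auto simp: scalar_matrices_def)
    have "inv\<^bsub>GL\<^esub> A = mat (inverse c)"
      using c by (intro inv_equality) (auto simp: carr, simp add: GL_def mat_mult_mat)
    with c show "inv\<^bsub>GL\<^esub> A \<in> scalar_matrices"
      by (auto simp: scalar_matrices_def intro!: exI[of _ "inverse c"])
  next
    fix A B :: "'a ^ 'n ^ 'n"
    assume "A \<in> scalar_matrices" "B \<in> scalar_matrices"
    then obtain c d where "A = mat c" "c \<noteq> 0" "B = mat d" "d \<noteq> 0"
      by (auto simp: scalar_matrices_def)
    then show "A \<otimes>\<^bsub>GL\<^esub> B \<in> scalar_matrices"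
      by (auto simp: scalar_matrices_def GL_def mat_mult_mat intro!: exI[of _ "c * d"])
  qed
  moreover have "A \<otimes>\<^bsub>GL\<^esub> B \<otimes>\<^bsub>GL\<^esub> inv\<^bsub>GL\<^esub> A \<in> scalar_matrices"
    if A: "A \<in> carrier GL" and B: "B \<in> scalar_matrices" for A B :: "'a ^ 'n ^ 'n"
  proof -
    obtain c where c: "B = mat c" "c \<noteq> 0"
      using B by (auto simp: scalar_matrices_def)
    have "A \<otimes>\<^bsub>GL\<^esub> B = B \<otimes>\<^bsub>GL\<^esub> A"
      using c by (simp add: GL_def mat_mult_commute)
    then have "A \<otimes>\<^bsub>GL\<^esub> B \<otimes>\<^bsub>GL\<^esub> inv\<^bsub>GL\<^esub> A = B"
      using A carr[OF c(2)] c(1) by (simp add: m_assoc)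
    then show ?thesis using B by simp
  qed
  ultimately show ?thesis
    by (simp add: normal_inv_iff)
qed

lemma group_PGL: "group (PGL :: ('a::field ^ 'n ^ 'n) set monoid)"
  unfolding PGL_def by (rule normal.factorgroup_is_group[OF scalar_matrices_normal])


section \<open>Partial flag varieties and the diagonal action\<close>

text \<open>A flag of type \<open>(k 1, \<dots>, k r)\<close> is an extensional family of subspaces indexed by \<open>{1..r}\<close>.\<close>

definition flags :: "nat \<Rightarrow> (nat \<Rightarrow> nat) \<Rightarrow> (nat \<Rightarrow> ('a::field ^ 'n) set) set"
  where "flags r k = {W \<in> (\<Pi>\<^sub>E i\<in>{1..r}. {U. vec.subspace U \<and> vec.dim U = k i}).
                        \<forall>i\<in>{1..r}. \<forall>j\<in>{1..r}. i < j \<longrightarrow> W i \<subseteq> W j}"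

definition flag_power ::
    "nat \<Rightarrow> nat \<Rightarrow> (nat \<Rightarrow> nat) \<Rightarrow> (nat \<Rightarrow> nat \<Rightarrow> ('a::field ^ 'n) set) set"
  where "flag_power m r k = (\<Pi>\<^sub>E l\<in>{1..m}. flags r k)"

text \<open>All matrices in a class \<open>C\<close> modulo scalars map a subspace to the same subspace, so the
  union below is the image under any representative of \<open>C\<close>.\<close>

definition PGL_image :: "('a::field ^ 'n ^ 'n) set \<Rightarrow> ('a ^ 'n) set \<Rightarrow> ('a ^ 'n) set"
  where "PGL_image C U = (\<Union>A\<in>C. (\<lambda>v. A *v v) ` U)"

definition diagonal_action ::
    "nat \<Rightarrow> nat \<Rightarrow> ('a::field ^ 'n ^ 'n) set
      \<Rightarrow> (nat \<Rightarrow> nat \<Rightarrow> ('a ^ 'n) set) \<Rightarrow> (nat \<Rightarrow> nat \<Rightarrow> ('a ^ 'n) set)"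
  where "diagonal_action m r C x = (\<lambda>l\<in>{1..m}. \<lambda>i\<in>{1..r}. PGL_image C (x l i))"


section \<open>The Zariski topology\<close>

text \<open>The product of flag varieties is embedded in the product, over \<open>l \<in> {1..m}\<close> and
  \<open>i \<in> {1..r}\<close>, of the projective spaces of the exterior powers of \<open>V\<close> of degree \<open>k i\<close>, via the
  Pluecker embedding of each member \<open>x l i\<close>. The coordinates are indexed by all sequences \<open>J\<close> of
  \<open>k i\<close> basis indices, not only the increasing ones; up to sign the additional coordinates are
  zero or repeat the usual ones, so the zero loci are unaffected.\<close>

definition pluecker_minor :: "(nat \<Rightarrow> 'a::field ^ 'n) \<Rightarrow> 'n list \<Rightarrow> 'a"
  where "pluecker_minor w J =
    (\<Sum>\<sigma> | \<sigma> permutes {..<length J}. of_int (sign \<sigma>) * (\<Prod>a<length J. w a $ (J ! \<sigma> a)))"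

text \<open>Changing the basis multiplies all Pluecker coordinates of a subspace by one nonzero factor,
  which is irrelevant for the vanishing of multihomogeneous polynomials.\<close>

definition subspace_basis :: "('a::field ^ 'n) set \<Rightarrow> nat \<Rightarrow> 'a ^ 'n"
  where "subspace_basis U = (SOME w. inj_on w {..<vec.dim U} \<and>
    vec.independent (w ` {..<vec.dim U}) \<and> vec.span (w ` {..<vec.dim U}) = U)"

definition pluecker_coords ::
    "(nat \<Rightarrow> nat \<Rightarrow> ('a::field ^ 'n) set) \<Rightarrow> nat \<times> nat \<times> 'n list \<Rightarrow> 'a"
  where "pluecker_coords x = (\<lambda>(l, i, J). pluecker_minor (subspace_basis (x l i)) J)"

inductive_set polynomial_functions :: "'i set \<Rightarrow> (('i \<Rightarrow> 'a::comm_ring_1) \<Rightarrow> 'a) set"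
  for I :: "'i set" where
  const: "(\<lambda>c. a) \<in> polynomial_functions I"
| coord: "s \<in> I \<Longrightarrow> (\<lambda>c. c s) \<in> polynomial_functions I"
| add: "f \<in> polynomial_functions I \<Longrightarrow> g \<in> polynomial_functions I
    \<Longrightarrow> (\<lambda>c. f c + g c) \<in> polynomial_functions I"
| mult: "f \<in> polynomial_functions I \<Longrightarrow> g \<in> polynomial_functions I
    \<Longrightarrow> (\<lambda>c. f c * g c) \<in> polynomial_functions I"

definition pluecker_indices :: "nat \<Rightarrow> nat \<Rightarrow> (nat \<Rightarrow> nat) \<Rightarrow> (nat \<times> nat \<times> 'n list) set"
  where "pluecker_indices m r k =
    {(l, i, J). l \<in> {1..m} \<and> i \<in> {1..r} \<and> length J = k i}"

text \<open>Over an infinite field, the scaling identity below says precisely that the polynomial is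
  homogeneous of degree \<open>d l i\<close> in the group of variables with first indices \<open>(l, i)\<close>.\<close>

definition multihomogeneous ::
    "nat \<Rightarrow> nat \<Rightarrow> (nat \<Rightarrow> nat) \<Rightarrow> ((nat \<times> nat \<times> 'n list \<Rightarrow> 'a::field) \<Rightarrow> 'a) set"
  where "multihomogeneous m r k = {f \<in> polynomial_functions (pluecker_indices m r k).
    \<exists>d :: nat \<Rightarrow> nat \<Rightarrow> nat. \<forall>t c.
      f (\<lambda>(l, i, J). t l i * c (l, i, J)) = (\<Prod>l=1..m. \<Prod>i=1..r. t l i ^ d l i) * f c}"

definition zero_locus ::
    "nat \<Rightarrow> nat \<Rightarrow> (nat \<Rightarrow> nat) \<Rightarrow> ((nat \<times> nat \<times> 'n list \<Rightarrow> 'a::field) \<Rightarrow> 'a) set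
      \<Rightarrow> (nat \<Rightarrow> nat \<Rightarrow> ('a ^ 'n) set) set"
  where "zero_locus m r k S = {x \<in> flag_power m r k. \<forall>f\<in>S. f (pluecker_coords x) = 0}"

definition zariski ::
    "nat \<Rightarrow> nat \<Rightarrow> (nat \<Rightarrow> nat) \<Rightarrow> (nat \<Rightarrow> nat \<Rightarrow> ('a::field ^ 'n) set) topology"
  where "zariski m r k =
    topology (\<lambda>U. \<exists>S \<subseteq> multihomogeneous m r k. U = flag_power m r k - zero_locus m r k S)"

lemma multihomogeneous_const: "(\<lambda>c. a :: 'a::field) \<in> multihomogeneous m r k"
proof -
  have "\<exists>d :: nat \<Rightarrow> nat \<Rightarrow> nat. \<forall>t :: nat \<Rightarrow> nat \<Rightarrow> 'a. a = (\<Prod>l=1..m. \<Prod>i=1..r. t l i ^ d l i) * a"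
    by (rule exI[of _ "\<lambda>_ _. 0"]) simp
  then show ?thesis
    unfolding multihomogeneous_def mem_Collect_eq by (blast intro: polynomial_functions.const)
qed

lemma multihomogeneous_mult:
  assumes "f \<in> multihomogeneous m r k" "g \<in> multihomogeneous m r k"
  shows "(\<lambda>c. f c * g c) \<in> multihomogeneous m r k"
proof -
  obtain d e :: "nat \<Rightarrow> nat \<Rightarrow> nat" where
    d: "\<And>t c. f (\<lambda>(l, i, J). t l i * c (l, i, J)) = (\<Prod>l=1..m. \<Prod>i=1..r. t l i ^ d l i) * f c" and
    e: "\<And>t c. g (\<lambda>(l, i, J). t l i * c (l, i, J)) = (\<Prod>l=1..m. \<Prod>i=1..r. t l i ^ e l i) * g c"
    using assms unfolding multihomogeneous_def by blast
  have "f (\<lambda>(l, i, J). t l i * c (l, i, J)) * g (\<lambda>(l, i, J). t l i * c (l, i, J))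
      = (\<Prod>l=1..m. \<Prod>i=1..r. t l i ^ (d l i + e l i)) * (f c * g c)" for t c
    unfolding d e power_add prod.distrib by (simp only: ac_simps)
  moreover have "(\<lambda>c. f c * g c) \<in> polynomial_functions (pluecker_indices m r k)"
    using assms unfolding multihomogeneous_def by (simp add: polynomial_functions.mult)
  ultimately show ?thesis
    unfolding multihomogeneous_def mem_Collect_eq
    by (intro conjI exI[of _ "\<lambda>l i. d l i + e l i"] allI)
qed

lemma istopology_zariski:
  "istopology (\<lambda>U. \<exists>S \<subseteq> multihomogeneous m r k.
     U = flag_power m r k - (zero_locus m r k S :: (nat \<Rightarrow> nat \<Rightarrow> ('a::field ^ 'n) set) set))"
  unfolding istopology_def
proof (intro conjI allI impI)
  fix U V :: "(nat \<Rightarrow> nat \<Rightarrow> ('a ^ 'n) set) set"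
  assume "\<exists>S \<subseteq> multihomogeneous m r k. U = flag_power m r k - zero_locus m r k S"
    and "\<exists>S \<subseteq> multihomogeneous m r k. V = flag_power m r k - zero_locus m r k S"
  then obtain S T where S: "S \<subseteq> multihomogeneous m r k" "U = flag_power m r k - zero_locus m r k S"
    and T: "T \<subseteq> multihomogeneous m r k" "V = flag_power m r k - zero_locus m r k T"
    by blast
  define P where "P = (\<lambda>(f, g) c. f c * g c) ` (S \<times> T)"
  have zero_P: "(\<forall>h\<in>P. h c = 0) \<longleftrightarrow> (\<forall>f\<in>S. f c = 0) \<or> (\<forall>g\<in>T. g c = 0)" for c
    unfolding P_def by auto
  have "zero_locus m r k P = zero_locus m r k S \<union> zero_locus m r k T"
    unfolding zero_locus_def zero_P by blast
  then have "U \<inter> V = flag_power m r k - zero_locus m r k P"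
    unfolding S(2) T(2) by blast
  moreover have "P \<subseteq> multihomogeneous m r k"
    using S(1) T(1) unfolding P_def by (auto intro!: multihomogeneous_mult)
  ultimately show "\<exists>S \<subseteq> multihomogeneous m r k. U \<inter> V = flag_power m r k - zero_locus m r k S"
    by blast
next
  fix \<U> :: "(nat \<Rightarrow> nat \<Rightarrow> ('a ^ 'n) set) set set"
  assume "\<forall>U\<in>\<U>. \<exists>S \<subseteq> multihomogeneous m r k. U = flag_power m r k - zero_locus m r k S"
  from bchoice[OF this] obtain S where
    "\<forall>U\<in>\<U>. S U \<subseteq> multihomogeneous m r k \<and> U = flag_power m r k - zero_locus m r k (S U)" ..
  then have S: "\<And>U. U \<in> \<U> \<Longrightarrow> S U \<subseteq> multihomogeneous m r k"
      "\<And>U. U \<in> \<U> \<Longrightarrow> U = flag_power m r k - zero_locus m r k (S U)"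
    by blast+
  have "(\<Union>U\<in>\<U>. U) = (\<Union>U\<in>\<U>. flag_power m r k - zero_locus m r k (S U))"
    by (rule SUP_cong[OF refl S(2)])
  also have "\<dots> = flag_power m r k - zero_locus m r k (\<Union>U\<in>\<U>. S U)"
    by (auto simp: zero_locus_def)
  finally have "\<Union>\<U> = flag_power m r k - zero_locus m r k (\<Union>U\<in>\<U>. S U)"
    by simp
  then show "\<exists>S \<subseteq> multihomogeneous m r k. \<Union>\<U> = flag_power m r k - zero_locus m r k S"
    using S(1) by (intro exI[of _ "\<Union>U\<in>\<U>. S U"] conjI UN_least)
qed

lemma openin_zariski:
  "openin (zariski m r k) U \<longleftrightarrow>
    (\<exists>S \<subseteq> multihomogeneous m r k. U = flag_power m r k - zero_locus m r k S)"
  unfolding zariski_def by (simp add: topology_inverse'[OF istopology_zariski])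

lemma topspace_zariski: "topspace (zariski m r k) = flag_power m r k"
proof (rule antisym)
  show "topspace (zariski m r k) \<subseteq> flag_power m r k"
    unfolding topspace_def openin_zariski by blast
  have "openin (zariski m r k) (flag_power m r k - zero_locus m r k {\<lambda>c. 1})"
    unfolding openin_zariski
    by (intro exI[of _ "{\<lambda>c. 1}"] conjI refl) (simp add: multihomogeneous_const)
  moreover have "flag_power m r k - zero_locus m r k {\<lambda>c. 1} = flag_power m r k"
    by (auto simp: zero_locus_def)
  ultimately show "flag_power m r k \<subseteq> topspace (zariski m r k)"
    using openin_subset by fastforce
qed

lemma closedin_zariski:
  "closedin (zariski m r k) Z \<longleftrightarrow> (\<exists>S \<subseteq> multihomogeneous m r k. Z = zero_locus m r k S)"
proof -
  have sub: "zero_locus m r k S \<subseteq> flag_power m r k"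
    for S :: "((nat \<times> nat \<times> 'b list \<Rightarrow> 'a) \<Rightarrow> 'a) set"
    by (auto simp: zero_locus_def)
  have "Z \<subseteq> flag_power m r k \<and> flag_power m r k - Z = flag_power m r k - zero_locus m r k S
      \<longleftrightarrow> Z = zero_locus m r k S" for S
    using sub[of S] by blast
  then show ?thesis
    unfolding closedin_def topspace_zariski openin_zariski by blast
qed


section \<open>Dense and sparse actions\<close>

text \<open>The field \<open>'a\<close> and the index type \<open>'n\<close> of the coordinates of \<open>V\<close> are passed as type
  arguments.\<close>

definition dense_action ::
    "'a::field itself \<Rightarrow> 'n::finite itself \<Rightarrow> nat \<Rightarrow> nat \<Rightarrow> (nat \<Rightarrow> nat) \<Rightarrow> bool"
  where "dense_action _ _ m r k \<longleftrightarrow>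
    (\<exists>x \<in> (flag_power m r k :: (nat \<Rightarrow> nat \<Rightarrow> ('a ^ 'n) set) set).
       Abstract_Topology.closure_of (zariski m r k) (orbit PGL (diagonal_action m r) x)
         = flag_power m r k)"

definition sparse_action ::
    "'a::field itself \<Rightarrow> 'n::finite itself \<Rightarrow> nat \<Rightarrow> nat \<Rightarrow> (nat \<Rightarrow> nat) \<Rightarrow> bool"
  where "sparse_action K N m r k \<longleftrightarrow> \<not> dense_action K N m r k"

end

theory Submission
  imports Defs
begin

text \<open>Suppose \<open>F\<close> and \<open>G\<close> are polynomials in the Pluecker coordinates of the same multidegree which are
  semi-invariants for the same character. If the orbit of \<open>x\<close> is dense, then every linear combination
  of \<open>F\<close> and \<open>G\<close> that vanishes at \<open>x\<close> vanishes identically. So there is no dense orbit as soon as there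
  is a point with \<open>F \<noteq> 0 = G\<close> and another one with \<open>G \<noteq> 0\<close>.

  For flags \<open>A\<^sub>l \<subseteq> B\<^sub>l\<close> of dimensions \<open>a\<close> and \<open>n - t a\<close>, fix \<open>t - 1\<close> of the \<open>A\<^sub>l\<close> and let \<open>D x y\<close> be the
  determinant formed by these together with \<open>A\<^sub>x\<close> and \<open>B\<^sub>y\<close>. Three further flags give the numerator
  \<open>F = D 1 2 * D 2 3 * D 3 1\<close> and the denominator \<open>G = D 1 3 * D 3 2 * D 2 1\<close> of a triple ratio.

  For \<open>A\<^sub>l \<subseteq> B\<^sub>l \<subseteq> C\<^sub>l\<close> of dimensions \<open>a\<close>, \<open>b\<close>, \<open>c\<close> with \<open>2 a + b + c = 2 n\<close>, replace \<open>D\<close> by the determinant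
  \<open>E x y z\<close> in \<open>V \<oplus> V\<close> formed by \<open>A\<^sub>x \<oplus> 0\<close>, \<open>B\<^sub>y \<oplus> 0\<close>, the diagonal copy of \<open>A\<^sub>z\<close>, and \<open>0 \<oplus> C\<^sub>x\<close>, and take the
  products over the two cyclic orientations of \<open>1, 2, 3\<close>.

  Laplace expansion along the blocks of rows turns such determinants into polynomials in the Pluecker
  coordinates.\<close>


section \<open>Alternating multilinear forms\<close>

text \<open>Families of \<open>d\<close> vectors are total functions, so that slots can be updated
  freely; \<open>local\<close> makes the entries from \<open>d\<close> on irrelevant. Vanishing at
  repeated vectors, rather than a sign rule, is the axiom that is meaningful in characteristic
  2.\<close>

locale alternating_form =
  fixes d :: nat and F :: "(nat \<Rightarrow> 'a::field ^ 'n) \<Rightarrow> 'a"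
  assumes add: "a < d \<Longrightarrow> F (w(a := x + y)) = F (w(a := x)) + F (w(a := y))"
    and scale: "a < d \<Longrightarrow> F (w(a := c *s x)) = c * F (w(a := x))"
    and alternating: "a < d \<Longrightarrow> b < d \<Longrightarrow> a \<noteq> b \<Longrightarrow> w a = w b \<Longrightarrow> F w = 0"
    and local: "(\<And>a. a < d \<Longrightarrow> w a = w' a) \<Longrightarrow> F w = F w'"
begin

lemma linear_sum:
  assumes "a < d" "finite B"
  shows "F (w(a := \<Sum>b\<in>B. c b *s y b)) = (\<Sum>b\<in>B. c b * F (w(a := y b)))"
  using assms(2)
proof induction
  case empty
  have "F (w(a := 0 *s 0)) = 0"
    unfolding scale[OF assms(1)] by simp
  then show ?case by (simp only: sum.empty vec.scale_zero_left)
next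
  case (insert b B)
  show ?case
    by (simp only: sum.insert[OF insert.hyps] add[OF assms(1)] scale[OF assms(1)] insert.IH)
qed

text \<open>Polarization: put \<open>w a + w b\<close> into both slots and expand.\<close>

lemma transpose:
  assumes "a < d" "b < d" "a \<noteq> b"
  shows "F (w \<circ> Transposition.transpose a b) = - F w"
proof -
  define W where "W u v = w(a := u, b := v)" for u v
  have W_swap: "W u v = w(b := v, a := u)" for u v
    using assms(3) by (auto simp: W_def)
  have diag: "F (W u u) = 0" for u
    by (rule alternating[OF assms]) (use assms in \<open>auto simp: W_def\<close>)
  have add1: "F (W (u + u') v) = F (W u v) + F (W u' v)" for u u' v
    unfolding W_swap by (rule add[OF assms(1)])
  have add2: "F (W u (v + v')) = F (W u v) + F (W u v')" for u v v'
    unfolding W_def by (rule add[OF assms(2)])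
  have "0 = F (W (w a + w b) (w a + w b))"
    by (rule diag[symmetric])
  also have "\<dots> = F (W (w a) (w a)) + F (W (w a) (w b)) + (F (W (w b) (w a)) + F (W (w b) (w b)))"
    by (simp only: add1 add2 add_ac)
  finally have "F (W (w a) (w b)) + F (W (w b) (w a)) = 0"
    by (simp add: diag)
  moreover have "W (w a) (w b) = w" "W (w b) (w a) = w \<circ> Transposition.transpose a b"
    by (auto simp: W_def fun_eq_iff Transposition.transpose_def)
  ultimately show ?thesis
    by (simp add: eq_neg_iff_add_eq_0 add.commute)
qed

lemma permute:
  assumes "\<sigma> permutes {..<d}"
  shows "F (w \<circ> \<sigma>) = of_int (sign \<sigma>) * F w"
  using assms finite_lessThan[of d]
proof (induction arbitrary: w rule: permutes_induct)
  case id
  show ?case by simp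
next
  case (swap a b \<sigma>)
  have "F (w \<circ> (Transposition.transpose a b \<circ> \<sigma>)) = F ((w \<circ> Transposition.transpose a b) \<circ> \<sigma>)"
    by (simp add: comp_assoc)
  also have "\<dots> = of_int (sign \<sigma>) * - F w"
    using swap.hyps by (simp only: swap.IH transpose lessThan_iff not_False_eq_True)
  also have "\<dots> = of_int (sign (Transposition.transpose a b \<circ> \<sigma>)) * F w"
    using swap.hyps permutes_imp_permutation[OF finite_lessThan swap.hyps(4)]
    by (simp add: sign_compose permutation_swap_id sign_swap_id)
  finally show ?case .
qed

lemma expand_functions:
  assumes "finite B"
  shows "F (\<lambda>a. \<Sum>b\<in>B. M a b *s y b) = (\<Sum>J\<in>{..<d} \<rightarrow>\<^sub>E B. (\<Prod>a<d. M a (J a)) * F (\<lambda>a. y (J a)))"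
proof -
  let ?z = "\<lambda>a. \<Sum>b\<in>B. M a b *s y b"
  \<comment> \<open>Induction on the number \<open>e\<close> of expanded slots. The tail
    \<open>z\<close> stays arbitrary, because the induction step first expands slot \<open>e\<close>
    and moves \<open>y b\<close> into the tail.\<close>
  have "F (\<lambda>a. if a < e then ?z a else z a) =
      (\<Sum>J\<in>{..<e} \<rightarrow>\<^sub>E B. (\<Prod>a<e. M a (J a)) * F (\<lambda>a. if a < e then y (J a) else z a))"
    if "e \<le> d" for e z
    using that
  proof (induction e arbitrary: z)
    case 0
    show ?case by simp
  next
    case (Suc e)
    then have e: "e < d" by simp
    have inj: "inj_on (\<lambda>(b, J). J(e := b)) (B \<times> ({..<e} \<rightarrow>\<^sub>E B))"
      by (rule inj_combinator) simp
    have "(\<lambda>a. if a < Suc e then ?z a else z a) = (\<lambda>a. if a < e then ?z a else z a)(e := ?z e)"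
      by (auto simp: fun_eq_iff less_Suc_eq)
    then have "F (\<lambda>a. if a < Suc e then ?z a else z a) =
        (\<Sum>b\<in>B. M e b * F ((\<lambda>a. if a < e then ?z a else z a)(e := y b)))"
      using linear_sum[OF e assms] by simp
    also have "\<dots> = (\<Sum>b\<in>B. M e b * F (\<lambda>a. if a < e then ?z a else (z(e := y b)) a))"
      by (intro sum.cong refl arg_cong2[of _ _ _ _ "(*)"] arg_cong[of _ _ F]) auto
    also have "\<dots> = (\<Sum>b\<in>B. \<Sum>J\<in>{..<e} \<rightarrow>\<^sub>E B. M e b * ((\<Prod>a<e. M a (J a)) *
        F (\<lambda>a. if a < e then y (J a) else (z(e := y b)) a)))"
      using Suc.IH e by (simp add: sum_distrib_left)
    also have "\<dots> = (\<Sum>(b, J)\<in>B \<times> ({..<e} \<rightarrow>\<^sub>E B). M e b * ((\<Prod>a<e. M a (J a)) *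
        F (\<lambda>a. if a < e then y (J a) else (z(e := y b)) a)))"
      by (rule sum.cartesian_product)
    also have "\<dots> = (\<Sum>(b, J)\<in>B \<times> ({..<e} \<rightarrow>\<^sub>E B). (\<Prod>a<Suc e. M a ((J(e := b)) a)) *
        F (\<lambda>a. if a < Suc e then y ((J(e := b)) a) else z a))"
    proof (rule sum.cong[OF refl], clarify)
      fix b J
      have "(\<lambda>a. if a < e then y (J a) else (z(e := y b)) a) =
          (\<lambda>a. if a < Suc e then y ((J(e := b)) a) else z a)"
        by (auto simp: fun_eq_iff less_Suc_eq)
      moreover have "(\<Prod>a<e. M a ((J(e := b)) a)) = (\<Prod>a<e. M a (J a))"
        by (rule prod.cong) auto
      ultimately show "M e b * ((\<Prod>a<e. M a (J a)) *
          F (\<lambda>a. if a < e then y (J a) else (z(e := y b)) a)) =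
          (\<Prod>a<Suc e. M a ((J(e := b)) a)) * F (\<lambda>a. if a < Suc e then y ((J(e := b)) a) else z a)"
        by (simp add: mult_ac)
    qed
    also have "\<dots> = (\<Sum>J\<in>{..<Suc e} \<rightarrow>\<^sub>E B. (\<Prod>a<Suc e. M a (J a)) *
        F (\<lambda>a. if a < Suc e then y (J a) else z a))"
      unfolding lessThan_Suc PiE_insert_eq
      by (subst sum.reindex[OF inj]) (simp add: case_prod_unfold)
    finally show ?case .
  qed
  from this[of d "\<lambda>_. 0"] have "F (\<lambda>a. if a < d then ?z a else 0) =
      (\<Sum>J\<in>{..<d} \<rightarrow>\<^sub>E B. (\<Prod>a<d. M a (J a)) * F (\<lambda>a. if a < d then y (J a) else 0))"
    by simp
  moreover have "F (\<lambda>a. if a < d then ?z a else 0) = F ?z"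
    by (rule local) simp
  moreover have "F (\<lambda>a. if a < d then y (J a) else 0) = F (\<lambda>a. y (J a))" for J
    by (rule local) simp
  ultimately show ?thesis by simp
qed

text \<open>Grouping the injective \<open>J\<close> above by their image, with \<open>\<beta> S\<close> a fixed enumeration of \<open>S\<close>.\<close>

lemma expand_subsets:
  assumes "finite B" and \<beta>: "\<And>S. S \<subseteq> B \<Longrightarrow> card S = d \<Longrightarrow> bij_betw (\<beta> S) {..<d} S"
  shows "F (\<lambda>a. \<Sum>b\<in>B. M a b *s y b) =
    (\<Sum>S | S \<subseteq> B \<and> card S = d.
      (\<Sum>\<sigma> | \<sigma> permutes {..<d}. of_int (sign \<sigma>) * (\<Prod>a<d. M a (\<beta> S (\<sigma> a)))) *
      F (\<lambda>a. y (\<beta> S a)))"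
proof -
  let ?I = "{J \<in> {..<d} \<rightarrow>\<^sub>E B. inj_on J {..<d}}"
  let ?S = "{S. S \<subseteq> B \<and> card S = d}"
  let ?P = "{\<sigma>. \<sigma> permutes {..<d}}"
  have "F (\<lambda>a. \<Sum>b\<in>B. M a b *s y b) = (\<Sum>J\<in>{..<d} \<rightarrow>\<^sub>E B. (\<Prod>a<d. M a (J a)) * F (\<lambda>a. y (J a)))"
    by (rule expand_functions[OF assms(1)])
  \<comment> \<open>A non-injective \<open>J\<close> repeats a vector, so its term vanishes.\<close>
  also have "\<dots> = (\<Sum>J\<in>?I. (\<Prod>a<d. M a (J a)) * F (\<lambda>a. y (J a)))"
  proof (rule sum.mono_neutral_right)
    show "finite ({..<d} \<rightarrow>\<^sub>E B)"
      using assms(1) by (intro finite_PiE) auto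
    show "\<forall>J\<in>({..<d} \<rightarrow>\<^sub>E B) - ?I. (\<Prod>a<d. M a (J a)) * F (\<lambda>a. y (J a)) = 0"
      by (auto simp: inj_on_def intro: alternating)
  qed auto
  \<comment> \<open>An injective \<open>J\<close> is \<open>\<beta> S \<circ> \<sigma>\<close> for
    \<open>S\<close> its image and a unique \<open>\<sigma>\<close>, which \<open>permute\<close>
    converts into a sign.\<close>
  also have "\<dots> = (\<Sum>(S, \<sigma>)\<in>?S \<times> ?P. of_int (sign \<sigma>) * (\<Prod>a<d. M a (\<beta> S (\<sigma> a))) * F (\<lambda>a. y (\<beta> S a)))"
  proof (rule sym, rule sum.reindex_bij_witness)
    let ?j = "\<lambda>(S, \<sigma>). \<lambda>a\<in>{..<d}. \<beta> S (\<sigma> a)"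
    let ?i = "\<lambda>J. (J ` {..<d}, \<lambda>a. if a < d then inv_into {..<d} (\<beta> (J ` {..<d})) (J a) else a)"
    fix p assume "p \<in> ?S \<times> ?P"
    then obtain S \<sigma> where p: "p = (S, \<sigma>)" and S: "S \<subseteq> B" "card S = d" and \<sigma>: "\<sigma> permutes {..<d}"
      by auto
    let ?J = "\<lambda>a\<in>{..<d}. \<beta> S (\<sigma> a)"
    note b = \<beta>[OF S]
    have "bij_betw (\<beta> S \<circ> \<sigma>) {..<d} S"
      using \<sigma> b by (intro bij_betw_trans[OF permutes_imp_bij])
    then have J: "bij_betw ?J {..<d} S"
      by (subst bij_betw_cong[where g = "\<beta> S \<circ> \<sigma>"]) auto
    then have "?J ` {..<d} \<subseteq> B" "inj_on ?J {..<d}"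
      using S(1) by (simp_all add: bij_betw_def)
    then show "?j p \<in> ?I"
      unfolding p by (auto simp: PiE_def)
    have "?J ` {..<d} = S"
      using J by (simp add: bij_betw_def)
    moreover have "(if a < d then inv_into {..<d} (\<beta> S) (?J a) else a) = \<sigma> a" for a
      using b permutes_in_image[OF \<sigma>, of a] permutes_not_in[OF \<sigma>, of a]
      by (auto simp: bij_betw_def)
    ultimately show "?i (?j p) = p"
      unfolding p by (simp only: prod.case)
    have "F (\<lambda>a. y (?J a)) = F ((\<lambda>a. y (\<beta> S a)) \<circ> \<sigma>)"
      by (rule local) simp
    then show "(\<Prod>a<d. M a (?j p a)) * F (\<lambda>a. y (?j p a)) =
        (case p of (S, \<sigma>) \<Rightarrow>
          of_int (sign \<sigma>) * (\<Prod>a<d. M a (\<beta> S (\<sigma> a))) * F (\<lambda>a. y (\<beta> S a)))"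
      unfolding p by (simp add: permute[OF \<sigma>])
  next
    let ?j = "\<lambda>(S, \<sigma>). \<lambda>a\<in>{..<d}. \<beta> S (\<sigma> a)"
    let ?i = "\<lambda>J. (J ` {..<d}, \<lambda>a. if a < d then inv_into {..<d} (\<beta> (J ` {..<d})) (J a) else a)"
    fix J assume "J \<in> ?I"
    then have J: "J \<in> {..<d} \<rightarrow>\<^sub>E B" "inj_on J {..<d}"
      by auto
    let ?T = "J ` {..<d}"
    let ?\<sigma> = "\<lambda>a. if a < d then inv_into {..<d} (\<beta> ?T) (J a) else a"
    have S: "?T \<subseteq> B"
      using J(1) by auto
    have card: "card ?T = d"
      using J(2) by (simp add: card_image)
    note b = \<beta>[OF S card]
    have "bij_betw (inv_into {..<d} (\<beta> ?T) \<circ> J) {..<d} {..<d}"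
      using J(2) by (intro bij_betw_trans[OF inj_on_imp_bij_betw] bij_betw_inv_into[OF b])
    then have "bij_betw ?\<sigma> {..<d} {..<d}"
      by (subst bij_betw_cong[where g = "inv_into {..<d} (\<beta> ?T) \<circ> J"]) auto
    then have "?\<sigma> permutes {..<d}"
      by (rule bij_imp_permutes) simp
    then show "?i J \<in> {S. S \<subseteq> B \<and> card S = d} \<times> ?P"
      using S card by simp
    have "\<beta> ?T (inv_into {..<d} (\<beta> ?T) (J a)) = J a" if "a < d" for a
      using b that by (intro f_inv_into_f) (auto simp: bij_betw_def)
    then show "?j (?i J) = J"
      using J(1) by (auto simp: fun_eq_iff PiE_def extensional_def)
  qed
  also have "\<dots> = (\<Sum>S\<in>?S. \<Sum>\<sigma>\<in>?P. of_int (sign \<sigma>) * (\<Prod>a<d. M a (\<beta> S (\<sigma> a))) * F (\<lambda>a. y (\<beta> S a)))"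
    by (rule sum.cartesian_product[symmetric])
  finally show ?thesis
    by (simp add: sum_distrib_right)
qed

end

section \<open>Base change and expansion into minors\<close>

text \<open>Leibniz determinant of a matrix whose size is a number instead of a type, since the
  dimensions \<open>k i\<close> vary.\<close>

definition transition_det :: "nat \<Rightarrow> (nat \<Rightarrow> nat \<Rightarrow> 'a::field) \<Rightarrow> 'a"
  where "transition_det d M = (\<Sum>\<sigma> | \<sigma> permutes {..<d}. of_int (sign \<sigma>) * (\<Prod>a<d. M a (\<sigma> a)))"

text \<open>Selects one of the Pluecker coordinates that agree up to sign, so that each subset is
  counted once.\<close>

definition enumeration :: "'n::finite set \<Rightarrow> 'n list"
  where "enumeration S = (SOME J. distinct J \<and> set J = S)"

lemma enumeration: "distinct (enumeration S)" "set (enumeration S) = S" "length (enumeration S) = card S"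
proof -
  have "\<exists>J. distinct J \<and> set J = S"
    using finite_distinct_list[of S] by auto
  from someI_ex[OF this] show *: "distinct (enumeration S)" "set (enumeration S) = S"
    by (auto simp: enumeration_def)
  then show "length (enumeration S) = card S"
    by (metis distinct_card)
qed

context alternating_form
begin

text \<open>In the expansion over subsets only \<open>{..<d}\<close> itself has \<open>d\<close>
  elements, so a single term survives.\<close>

lemma base_change:
  assumes "\<And>a. a < d \<Longrightarrow> w' a = (\<Sum>b<d. M a b *s w b)"
  shows "F w' = transition_det d M * F w"
proof -
  have S: "{S. S \<subseteq> {..<d} \<and> card S = d} = {{..<d}}"
    using card_subset_eq[of "{..<d}"] by auto
  have "F w' = F (\<lambda>a. \<Sum>b<d. M a b *s w b)"
    by (rule local) (rule assms)
  also have "\<dots> = transition_det d M * F w"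
    by (subst expand_subsets[where \<beta> = "\<lambda>_ a. a"])
      (use S in \<open>auto simp: transition_det_def bij_betw_def dest: card_subset_eq[rotated -1]\<close>)
  finally show ?thesis .
qed

text \<open>Expanding all vectors in the standard basis, the coefficient belonging to a subset is
  exactly a Pluecker minor. This is the source of all polynomials in Pluecker coordinates
  below.\<close>

lemma expand_minors:
  "F w = (\<Sum>S | card S = d. pluecker_minor w (enumeration S) * F (\<lambda>a. axis (enumeration S ! a) 1))"
proof -
  have w: "(\<Sum>j\<in>UNIV. w a $ j *s axis j 1) = w a" for a
    by (rule basis_expansion)
  have "F w = F (\<lambda>a. \<Sum>j\<in>UNIV. w a $ j *s axis j 1)"
    by (simp add: w)
  also have "\<dots> = (\<Sum>S | S \<subseteq> UNIV \<and> card S = d. (\<Sum>\<sigma> | \<sigma> permutes {..<d}. of_int (sign \<sigma>) *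
      (\<Prod>a<d. w a $ (enumeration S ! \<sigma> a))) * F (\<lambda>a. axis (enumeration S ! a) 1))"
  proof (rule expand_subsets)
    fix S :: "'n set" assume "card S = d"
    then show "bij_betw ((!) (enumeration S)) {..<d} S"
      using bij_betw_nth[of "enumeration S" "{..<d}" S] by (simp add: enumeration)
  qed simp
  also have "\<dots> = (\<Sum>S | card S = d.
      pluecker_minor w (enumeration S) * F (\<lambda>a. axis (enumeration S ! a) 1))"
    by (rule sum.cong) (auto simp: pluecker_minor_def enumeration(3))
  finally show ?thesis .
qed

text \<open>A vector in the span of the others, expanded in its own slot, produces only terms with a
  repeated vector.\<close>

lemma nonzero_imp_independent:
  assumes "F w \<noteq> 0"
  shows "inj_on w {..<d}" "vec.independent (w ` {..<d})"
proof -
  show inj: "inj_on w {..<d}"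
    using assms alternating by (auto simp: inj_on_def)
  show "vec.independent (w ` {..<d})"
  proof
    assume "vec.dependent (w ` {..<d})"
    then obtain a where a: "a < d" and span: "w a \<in> vec.span (w ` {..<d} - {w a})"
      unfolding vec.dependent_def by auto
    have "w ` {..<d} - {w a} = w ` ({..<d} - {a})"
      using inj a by (auto simp: inj_on_def)
    with span have "w a \<in> vec.span (w ` ({..<d} - {a}))"
      by simp
    then obtain c where "w a = (\<Sum>v\<in>w ` ({..<d} - {a}). c v *s v)"
      by (auto simp: vec.span_finite)
    also have "\<dots> = (\<Sum>b\<in>{..<d} - {a}. c (w b) *s w b)"
      using inj by (subst sum.reindex) (auto intro: inj_on_subset)
    finally have "F (w(a := w a)) = F (w(a := (\<Sum>b\<in>{..<d} - {a}. c (w b) *s w b)))"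
      by simp
    also have "\<dots> = (\<Sum>b\<in>{..<d} - {a}. c (w b) * F (w(a := w b)))"
      by (rule linear_sum[OF a]) simp
    also have "\<dots> = 0"
    proof (intro sum.neutral ballI)
      fix b assume "b \<in> {..<d} - {a}"
      then have "F (w(a := w b)) = 0"
        using a by (intro alternating[of a b]) auto
      then show "c (w b) * F (w(a := w b)) = 0"
        by simp
    qed
    finally show False
      using assms by simp
  qed
qed

end


section \<open>Multihomogeneous polynomials in the Pluecker coordinates\<close>

text \<open>Unlike in \<open>multihomogeneous\<close>, the degree is a parameter, so sums of equal
  degree can be formed. As a multiset of pairs \<open>(l, i)\<close> it adds up under products and
  can be read off a list of blocks.\<close>

definition multidegree ::
    "nat \<Rightarrow> nat \<Rightarrow> (nat \<Rightarrow> nat) \<Rightarrow> (nat \<times> nat) multiset \<Rightarrow> ((nat \<times> nat \<times> 'n list \<Rightarrow> 'a::field) \<Rightarrow> 'a) set"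
  where "multidegree m r k \<B> = {f \<in> polynomial_functions (pluecker_indices m r k).
    \<forall>t c. f (\<lambda>(l, i, J). t l i * c (l, i, J)) = (\<Prod>(l, i)\<in>#\<B>. t l i) * f c}"

lemma multidegree_const: "(\<lambda>c. a) \<in> multidegree m r k {#}"
  by (auto simp: multidegree_def polynomial_functions.const)

lemma multidegree_add:
  assumes "f \<in> multidegree m r k \<B>" "g \<in> multidegree m r k \<B>"
  shows "(\<lambda>c. f c + g c) \<in> multidegree m r k \<B>"
  using assms by (auto simp: multidegree_def algebra_simps intro: polynomial_functions.add)

lemma multidegree_mult:
  assumes "f \<in> multidegree m r k \<A>" "g \<in> multidegree m r k \<B>"
  shows "(\<lambda>c. f c * g c) \<in> multidegree m r k (\<A> + \<B>)"
  using assms by (auto simp: multidegree_def algebra_simps intro: polynomial_functions.mult)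

lemma multidegree_scale:
  assumes "f \<in> multidegree m r k \<B>"
  shows "(\<lambda>c. a * f c) \<in> multidegree m r k \<B>"
  using multidegree_mult[OF multidegree_const assms] by simp

lemma multidegree_sum:
  assumes "finite S" "S \<noteq> {}" "\<And>s. s \<in> S \<Longrightarrow> f s \<in> multidegree m r k \<B>"
  shows "(\<lambda>c. \<Sum>s\<in>S. f s c) \<in> multidegree m r k \<B>"
  using assms by (induction rule: finite_ne_induct) (auto intro: multidegree_add)

lemma multidegree_coord:
  assumes "l \<in> {1..m}" "i \<in> {1..r}" "length J = k i"
  shows "(\<lambda>c. c (l, i, J)) \<in> multidegree m r k {#(l, i)#}"
  using assms by (auto simp: multidegree_def pluecker_indices_def intro!: polynomial_functions.coord)

lemma multidegree_imp_multihomogeneous: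
  assumes "f \<in> multidegree m r k \<B>" and \<B>: "set_mset \<B> \<subseteq> {1..m} \<times> {1..r}"
  shows "f \<in> multihomogeneous m r k"
proof -
  have "(\<Prod>(l, i)\<in>#\<B>. t l i) = (\<Prod>l=1..m. \<Prod>i=1..r. t l i ^ count \<B> (l, i))" for t :: "nat \<Rightarrow> nat \<Rightarrow> 'b"
  proof -
    have "(\<Prod>(l, i)\<in>#\<B>. t l i) = (\<Prod>p\<in>set_mset \<B>. case_prod t p ^ count \<B> p)"
      by (rule image_prod_mset_multiplicity)
    also have "\<dots> = (\<Prod>p\<in>{1..m} \<times> {1..r}. case_prod t p ^ count \<B> p)"
      using \<B> by (intro prod.mono_neutral_left) (auto simp: not_in_iff)
    also have "\<dots> = (\<Prod>l=1..m. \<Prod>i=1..r. t l i ^ count \<B> (l, i))"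
      by (simp add: prod.cartesian_product case_prod_unfold)
    finally show ?thesis .
  qed
  with assms(1) show ?thesis
    unfolding multidegree_def multihomogeneous_def by (auto intro!: exI[of _ "\<lambda>l i. count \<B> (l, i)"])
qed


section \<open>Determinants of block matrices\<close>

text \<open>The ambient space is V tensored with the functions on \<open>'s\<close>: V itself for
  \<open>unit\<close>, and V \<oplus> V for \<open>bool\<close>, where the two indicator functions
  select the summands and the constant 1 the diagonal.\<close>

definition tensor :: "('s::finite \<Rightarrow> 'a) \<Rightarrow> 'a::field ^ 'n \<Rightarrow> 'a ^ ('n \<times> 's)"
  where "tensor u x = (\<chi> c. u (snd c) * x $ fst c)"

lemma tensor_add: "tensor u (x + y) = tensor u x + tensor u y"
  and tensor_scale: "tensor u (c *s x) = c *s tensor u x"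
  by (simp_all add: tensor_def vec_eq_iff algebra_simps)

text \<open>A block \<open>((l, i), u)\<close> stands for the rows \<open>u \<otimes> w\<close>, for \<open>w\<close> in a basis of the \<open>i\<close>-th member of the
  \<open>l\<close>-th flag.\<close>

type_synonym ('a, 's) blocks = "((nat \<times> nat) \<times> ('s \<Rightarrow> 'a)) list"

abbreviation block_size :: "(nat \<Rightarrow> nat) \<Rightarrow> ('a, 's) blocks \<Rightarrow> nat \<Rightarrow> nat"
  where "block_size k Bs q \<equiv> k (snd (fst (Bs ! q)))"

definition row_labels :: "(nat \<Rightarrow> nat) \<Rightarrow> ('a, 's) blocks \<Rightarrow> (nat \<times> nat) set"
  where "row_labels k Bs = (SIGMA q:{..<length Bs}. {..<block_size k Bs q})"

text \<open>\<open>det\<close> needs rows and columns of one index type. For square block lists any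
  bijection will do, as another one changes the determinant only by a sign that does not depend on
  the vectors.\<close>

definition row_label :: "(nat \<Rightarrow> nat) \<Rightarrow> ('a, 's) blocks \<Rightarrow> 'c \<Rightarrow> nat \<times> nat"
  where "row_label k Bs = (SOME \<phi>. bij_betw \<phi> UNIV (row_labels k Bs))"

definition block_row :: "('a::field, 's::finite) blocks \<Rightarrow> (nat \<Rightarrow> nat \<Rightarrow> 'a ^ 'n) \<Rightarrow> nat \<times> nat \<Rightarrow> 'a ^ ('n \<times> 's)"
  where "block_row Bs v = (\<lambda>(q, a). tensor (snd (Bs ! q)) (v q a))"

definition block_det :: "(nat \<Rightarrow> nat) \<Rightarrow> ('a::field, 's::finite) blocks \<Rightarrow> (nat \<Rightarrow> nat \<Rightarrow> 'a ^ 'n) \<Rightarrow> 'a"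
  where "block_det k Bs v = det (\<chi> \<rho>. block_row Bs v (row_label k Bs \<rho>))"

definition square :: "'n::finite itself \<Rightarrow> (nat \<Rightarrow> nat) \<Rightarrow> ('a, 's::finite) blocks \<Rightarrow> bool"
  where "square N k Bs \<longleftrightarrow> (\<Sum>q<length Bs. block_size k Bs q) = CARD('n) * CARD('s)"

lemma bij_row_label:
  fixes Bs :: "('a, 's::finite) blocks"
  assumes "square TYPE('n::finite) k Bs"
  shows "bij_betw (row_label k Bs) (UNIV :: ('n \<times> 's) set) (row_labels k Bs)"
proof -
  have "card (UNIV :: ('n \<times> 's) set) = card (row_labels k Bs)"
    using assms by (simp add: square_def row_labels_def)
  then have "\<exists>\<phi>. bij_betw \<phi> (UNIV :: ('n \<times> 's) set) (row_labels k Bs)"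
    by (intro finite_same_card_bij) (auto simp: row_labels_def)
  then show ?thesis
    unfolding row_label_def by (rule someI_ex)
qed

context
  fixes Bs :: "('a::field, 's::finite) blocks" and k :: "nat \<Rightarrow> nat" and N :: "'n::finite itself"
  assumes square: "square N k Bs"
begin

lemma bij: "bij_betw (row_label k Bs) (UNIV :: ('n \<times> 's) set) (row_labels k Bs)"
  using square by (intro bij_row_label) (simp add: square_def)

lemma obtain_row:
  assumes "q < length Bs" "a < block_size k Bs q"
  obtains \<rho> :: "'n \<times> 's" where "row_label k Bs \<rho> = (q, a)"
proof -
  have "(q, a) \<in> range (row_label k Bs :: 'n \<times> 's \<Rightarrow> _)"
    using assms bij by (simp add: bij_betw_def row_labels_def)
  then show ?thesis
    by (metis rangeE that)
qed

lemma row_label_mem: "row_label k Bs (\<rho> :: 'n \<times> 's) \<in> row_labels k Bs"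
  using bij by (rule bij_betwE[THEN bspec]) simp

lemma row_label_eq_iff: "row_label k Bs \<rho> = row_label k Bs \<rho>' \<longleftrightarrow> \<rho> = (\<rho>' :: 'n \<times> 's)"
  using bij by (auto simp only: bij_betw_def inj_on_eq_iff UNIV_I)

lemma block_det_local:
  fixes v v' :: "nat \<Rightarrow> nat \<Rightarrow> 'a ^ 'n"
  assumes "\<And>q a. q < length Bs \<Longrightarrow> a < block_size k Bs q \<Longrightarrow> v q a = v' q a"
  shows "block_det k Bs v = block_det k Bs v'"
proof -
  have "block_row Bs v (row_label k Bs \<rho>) = block_row Bs v' (row_label k Bs \<rho>)" for \<rho> :: "'n \<times> 's"
    using row_label_mem[of \<rho>] assms
    by (auto simp: row_labels_def block_row_def split: prod.split)
  then show ?thesis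
    by (simp add: block_det_def)
qed

lemma block_det_identical_rows:
  fixes v :: "nat \<Rightarrow> nat \<Rightarrow> 'a ^ 'n"
  assumes "q < length Bs" "a < block_size k Bs q" "q' < length Bs" "a' < block_size k Bs q'"
    and "(q, a) \<noteq> (q', a')" and "block_row Bs v (q, a) = block_row Bs v (q', a')"
  shows "block_det k Bs v = 0"
proof -
  obtain \<rho> \<rho>' :: "'n \<times> 's" where "row_label k Bs \<rho> = (q, a)" "row_label k Bs \<rho>' = (q', a')"
    using assms obtain_row by metis
  with assms show ?thesis
    unfolding block_det_def
    by (intro det_identical_rows[of \<rho> \<rho>']) (auto simp: row_def)
qed

text \<open>Makes base change and minor expansion available for one block at a time, with the other
  blocks frozen.\<close>

lemma alternating_block_det:
  fixes v :: "nat \<Rightarrow> nat \<Rightarrow> 'a ^ 'n"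
  assumes q: "q < length Bs"
  shows "alternating_form (block_size k Bs q) (\<lambda>x. block_det k Bs (v(q := x)))"
proof
  \<comment> \<open>Since the labelling is injective, changing vector \<open>a\<close> of block
    \<open>q\<close> changes exactly one row \<open>\<rho>\<close>, and linearity of
    \<open>det\<close> in that row applies.\<close>
  have update: "\<exists>\<rho>. \<forall>z. block_det k Bs (v(q := w(a := z))) =
      det (\<chi> \<rho>'. if \<rho>' = \<rho> then tensor (snd (Bs ! q)) z else block_row Bs (v(q := w)) (row_label k Bs \<rho>'))"
    if "a < block_size k Bs q" for a and w :: "nat \<Rightarrow> 'a ^ 'n"
  proof -
    obtain \<rho> :: "'n \<times> 's" where \<rho>: "row_label k Bs \<rho> = (q, a)"
      using obtain_row q \<open>a < block_size k Bs q\<close> by metis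
    have "block_row Bs (v(q := w(a := z))) (row_label k Bs \<rho>') =
        (if \<rho>' = \<rho> then tensor (snd (Bs ! q)) z else block_row Bs (v(q := w)) (row_label k Bs \<rho>'))" for z \<rho>'
    proof (cases "\<rho>' = \<rho>")
      case True
      then show ?thesis by (simp add: \<rho> block_row_def)
    next
      case False
      then have "row_label k Bs \<rho>' \<noteq> (q, a)"
        using row_label_eq_iff[of \<rho>' \<rho>] \<rho> by simp
      with False show ?thesis by (auto simp: block_row_def split: prod.split)
    qed
    then have "\<forall>z. block_det k Bs (v(q := w(a := z))) =
        det (\<chi> \<rho>'. if \<rho>' = \<rho> then tensor (snd (Bs ! q)) z else block_row Bs (v(q := w)) (row_label k Bs \<rho>'))"
      unfolding block_det_def by (simp only: simp_thms)
    then show ?thesis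
      by (rule exI)
  qed
  show "block_det k Bs (v(q := w(a := x + y))) =
      block_det k Bs (v(q := w(a := x))) + block_det k Bs (v(q := w(a := y)))"
    if a: "a < block_size k Bs q" for w a x y
  proof -
    obtain \<rho> where "\<And>z. block_det k Bs (v(q := w(a := z))) = det (\<chi> \<rho>'. if \<rho>' = \<rho>
        then tensor (snd (Bs ! q)) z else block_row Bs (v(q := w)) (row_label k Bs \<rho>'))"
      using update[OF a, of w] by blast
    then show ?thesis
      by (simp only: tensor_add det_row_add)
  qed
  show "block_det k Bs (v(q := w(a := c *s x))) = c * block_det k Bs (v(q := w(a := x)))"
    if a: "a < block_size k Bs q" for w a c x
  proof -
    obtain \<rho> where "\<And>z. block_det k Bs (v(q := w(a := z))) = det (\<chi> \<rho>'. if \<rho>' = \<rho>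
        then tensor (snd (Bs ! q)) z else block_row Bs (v(q := w)) (row_label k Bs \<rho>'))"
      using update[OF a, of w] by blast
    then show ?thesis
      by (simp only: tensor_scale det_row_mul)
  qed
  show "block_det k Bs (v(q := w)) = 0"
    if "a < block_size k Bs q" "b < block_size k Bs q" "a \<noteq> b" "w a = w b" for a b w
    using that q by (intro block_det_identical_rows[of q a q b]) (auto simp: block_row_def)
  show "block_det k Bs (v(q := w)) = block_det k Bs (v(q := w'))"
    if "\<And>a. a < block_size k Bs q \<Longrightarrow> w a = w' a" for w w'
    using that by (intro block_det_local) auto
qed

text \<open>The determinant is nonzero once the rows span. Phrasing this with an arbitrary subspace
  \<open>H\<close> lets later proofs collect vectors of \<open>H\<close> one after another.\<close>

lemma block_det_nonzero:
  fixes v :: "nat \<Rightarrow> nat \<Rightarrow> 'a ^ 'n"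
  assumes "\<And>H. vec.subspace H \<Longrightarrow>
    (\<And>q a. q < length Bs \<Longrightarrow> a < block_size k Bs q \<Longrightarrow> tensor (snd (Bs ! q)) (v q a) \<in> H) \<Longrightarrow> H = UNIV"
  shows "block_det k Bs v \<noteq> 0"
proof -
  let ?M = "\<chi> \<rho>. block_row Bs v (row_label k Bs \<rho>) :: 'a ^ ('n \<times> 's) ^ ('n \<times> 's)"
  have rows: "rows ?M = range (\<lambda>\<rho> :: 'n \<times> 's. block_row Bs v (row_label k Bs \<rho>))"
    unfolding rows_def row_def vec_lambda_eta by auto
  have "vec.span (rows ?M) = UNIV"
  proof (rule assms)
    fix q a assume "q < length Bs" "a < block_size k Bs q"
    then obtain \<rho> :: "'n \<times> 's" where "row_label k Bs \<rho> = (q, a)"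
      using obtain_row by metis
    then have "tensor (snd (Bs ! q)) (v q a) = block_row Bs v (row_label k Bs \<rho>)"
      by (simp add: block_row_def)
    then show "tensor (snd (Bs ! q)) (v q a) \<in> vec.span (rows ?M)"
      unfolding rows by (auto intro: vec.span_base)
  qed simp
  then show ?thesis
    unfolding block_det_def
    by (metis invertible_det_nz invertible_left_inverse matrix_left_invertible_span_rows_gen)
qed

lemma block_det_nonzero_imp_independent:
  fixes v :: "nat \<Rightarrow> nat \<Rightarrow> 'a ^ 'n"
  assumes "block_det k Bs v \<noteq> 0" "q < length Bs"
  shows "inj_on (v q) {..<block_size k Bs q}" "vec.independent (v q ` {..<block_size k Bs q})"
  using alternating_form.nonzero_imp_independent[OF alternating_block_det[OF assms(2), of v], of "v q"]
    assms(1) by auto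

text \<open>The blocks are replaced from the left one by one. A label occurring in several blocks
  contributes its factor each time, hence the product over a multiset.\<close>

lemma block_det_base_change:
  fixes w w' :: "nat \<times> nat \<Rightarrow> nat \<Rightarrow> 'a ^ 'n"
  assumes M: "\<And>l i a. (l, i) \<in> set (map fst Bs) \<Longrightarrow> a < k i \<Longrightarrow>
    w' (l, i) a = (\<Sum>b<k i. M (l, i) a b *s w (l, i) b)"
  shows "block_det k Bs (\<lambda>q. w' (fst (Bs ! q))) =
    (\<Prod>p\<in>#mset (map fst Bs). transition_det (k (snd p)) (M p)) * block_det k Bs (\<lambda>q. w (fst (Bs ! q)))"
proof -
  let ?v = "\<lambda>e q. if q < e then w' (fst (Bs ! q)) else w (fst (Bs ! q))"
  have "block_det k Bs (?v e) = (\<Prod>p\<in>#mset (map fst (take e Bs)). transition_det (k (snd p)) (M p)) *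
      block_det k Bs (?v 0)" if "e \<le> length Bs" for e
    using that
  proof (induction e)
    case 0
    show ?case by simp
  next
    case (Suc e)
    then have e: "e < length Bs" by simp
    interpret alternating_form "block_size k Bs e" "\<lambda>x. block_det k Bs ((?v e)(e := x))"
      by (rule alternating_block_det[OF e])
    obtain l i where li: "fst (Bs ! e) = (l, i)"
      by fastforce
    have "(l, i) \<in> set (map fst Bs)"
      using li e by (metis length_map nth_map nth_mem)
    then have "block_det k Bs ((?v e)(e := w' (l, i))) =
        transition_det (k i) (M (l, i)) * block_det k Bs ((?v e)(e := w (l, i)))"
      using base_change[of "w' (l, i)" "M (l, i)" "w (l, i)"] M li by simp
    moreover have "(?v e)(e := w (l, i)) = ?v e" "(?v e)(e := w' (l, i)) = ?v (Suc e)"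
      by (auto simp: fun_eq_iff li less_Suc_eq)
    ultimately show ?case
      using Suc.IH e li by (simp add: take_Suc_conv_app_nth mult_ac)
  qed
  from this[of "length Bs"] have "block_det k Bs (?v (length Bs)) =
      (\<Prod>p\<in>#mset (map fst Bs). transition_det (k (snd p)) (M p)) * block_det k Bs (?v 0)"
    by simp
  moreover have "block_det k Bs (?v (length Bs)) = block_det k Bs (\<lambda>q. w' (fst (Bs ! q)))"
    by (rule block_det_local) simp
  ultimately show ?thesis by simp
qed

text \<open>Laplace expansion one block at a time: each block becomes a combination of minors whose
  coefficients are determinants with standard basis vectors in that block.\<close>

lemma block_det_laplace:
  assumes "set (map fst Bs) \<subseteq> {1..m} \<times> {1..r}"
    and k: "\<And>i. i \<in> {1..r} \<Longrightarrow> k i \<le> CARD('n)"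
  shows "\<exists>P\<in>multidegree m r k (mset (map fst Bs)). \<forall>w :: nat \<times> nat \<Rightarrow> nat \<Rightarrow> 'a ^ 'n.
    block_det k Bs (\<lambda>q. w (fst (Bs ! q))) = P (\<lambda>(l, i, J). pluecker_minor (w (l, i)) J)"
proof -
  \<comment> \<open>Blocks from \<open>e\<close> on carry fixed vectors \<open>v\<close>; the step
    uses the hypothesis for every choice of standard basis vectors in block
    \<open>e\<close>.\<close>
  have "\<exists>P\<in>multidegree m r k (mset (map fst (take e Bs))). \<forall>w :: nat \<times> nat \<Rightarrow> nat \<Rightarrow> 'a ^ 'n.
      block_det k Bs (\<lambda>q. if q < e then w (fst (Bs ! q)) else v q) =
        P (\<lambda>(l, i, J). pluecker_minor (w (l, i)) J)" if "e \<le> length Bs" for e v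
    using that
  proof (induction e arbitrary: v)
    case 0
    show ?case
      by (auto intro: bexI[OF _ multidegree_const])
  next
    case (Suc e)
    then have e: "e < length Bs" by simp
    obtain l i where li: "fst (Bs ! e) = (l, i)"
      by fastforce
    have "(l, i) \<in> set (map fst Bs)"
      using li e by (metis length_map nth_map nth_mem)
    with assms(1) have li_mem: "l \<in> {1..m}" "i \<in> {1..r}"
      by auto
    let ?S = "{S :: 'n set. card S = k i}"
    let ?x = "\<lambda>S a. axis (enumeration S ! a) 1 :: 'a ^ 'n"
    have "\<forall>S. \<exists>P\<in>multidegree m r k (mset (map fst (take e Bs))). \<forall>w :: nat \<times> nat \<Rightarrow> nat \<Rightarrow> 'a ^ 'n.
        block_det k Bs (\<lambda>q. if q < e then w (fst (Bs ! q)) else (v(e := ?x S)) q) =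
          P (\<lambda>(l, i, J). pluecker_minor (w (l, i)) J)"
      using Suc.IH[of "v(e := ?x S)" for S] e by simp
    then obtain P where P: "\<And>S. P S \<in> multidegree m r k (mset (map fst (take e Bs)))"
      and det_P: "\<And>S w. block_det k Bs (\<lambda>q. if q < e then w (fst (Bs ! q)) else (v(e := ?x S)) q) =
          P S (\<lambda>(l, i, J). pluecker_minor (w (l, i)) J)"
      by metis
    define R where "R = (\<lambda>c. \<Sum>S\<in>?S. c (l, i, enumeration S) * P S c)"
    \<comment> \<open>The bound on \<open>k i\<close> makes the sum nonempty, as
      \<open>multidegree_sum\<close> requires.\<close>
    have "\<exists>S. S \<in> ?S"
      using obtain_subset_with_card_n[of "k i" "UNIV :: 'n set"] k[OF li_mem(2)] by blast
    then have "?S \<noteq> {}"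
      by blast
    then have "R \<in> multidegree m r k ({#(l, i)#} + mset (map fst (take e Bs)))"
      unfolding R_def
      by (intro multidegree_sum multidegree_mult multidegree_coord P li_mem)
        (auto simp: enumeration(3))
    then have "R \<in> multidegree m r k (mset (map fst (take (Suc e) Bs)))"
      using e li by (simp add: take_Suc_conv_app_nth)
    moreover have "block_det k Bs (\<lambda>q. if q < Suc e then w (fst (Bs ! q)) else v q) =
        R (\<lambda>(l, i, J). pluecker_minor (w (l, i)) J)" for w :: "nat \<times> nat \<Rightarrow> nat \<Rightarrow> 'a ^ 'n"
    proof -
      let ?v = "\<lambda>q. if q < e then w (fst (Bs ! q)) else v q"
      interpret alternating_form "block_size k Bs e" "\<lambda>x. block_det k Bs (?v(e := x))"
        by (rule alternating_block_det[OF e])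
      have "(\<lambda>q. if q < Suc e then w (fst (Bs ! q)) else v q) = ?v(e := w (l, i))"
        by (auto simp: fun_eq_iff li less_Suc_eq)
      moreover have "?v(e := ?x S) = (\<lambda>q. if q < e then w (fst (Bs ! q)) else (v(e := ?x S)) q)" for S
        by (auto simp: fun_eq_iff)
      ultimately show ?thesis
        using expand_minors[of "w (l, i)"] by (simp only: R_def li det_P snd_conv prod.case)
    qed
    ultimately show ?case
      by blast
  qed
  from this[of "length Bs" "\<lambda>_ _. 0"] obtain P where
    P: "P \<in> multidegree m r k (mset (map fst Bs))"
    and det_P: "\<And>w :: nat \<times> nat \<Rightarrow> nat \<Rightarrow> 'a ^ 'n.
      block_det k Bs (\<lambda>q. if q < length Bs then w (fst (Bs ! q)) else (\<lambda>_. 0)) =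
        P (\<lambda>(l, i, J). pluecker_minor (w (l, i)) J)"
    by auto
  have "block_det k Bs (\<lambda>q. w (fst (Bs ! q))) = P (\<lambda>(l, i, J). pluecker_minor (w (l, i)) J)"
    for w :: "nat \<times> nat \<Rightarrow> nat \<Rightarrow> 'a ^ 'n"
    by (rule trans[OF block_det_local det_P]) simp
  then show ?thesis
    using P by blast
qed

end

definition tensor_matrix :: "'a::field ^ 'n ^ 'n \<Rightarrow> 'a ^ ('n \<times> 's::finite) ^ ('n \<times> 's)"
  where "tensor_matrix A = (\<chi> c c'. if snd c = snd c' then A $ fst c $ fst c' else 0)"

lemma tensor_matrix_mult:
  fixes u :: "'s::finite \<Rightarrow> 'a::field"
  shows "tensor u (A *v x) = tensor_matrix A *v tensor u x"
proof -
  have "(\<Sum>c\<in>UNIV. (if \<sigma> = snd c then A $ j $ fst c else 0) * (u (snd c) * x $ fst c)) =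
      u \<sigma> * (\<Sum>j'\<in>UNIV. A $ j $ j' * x $ j')" for \<sigma> j
  proof -
    have "(\<Sum>c\<in>UNIV. (if \<sigma> = snd c then A $ j $ fst c else 0) * (u (snd c) * x $ fst c)) =
        (\<Sum>(j', \<sigma>')\<in>UNIV \<times> UNIV. (if \<sigma> = \<sigma>' then A $ j $ j' else 0) * (u \<sigma>' * x $ j'))"
      by (simp add: case_prod_unfold)
    also have "\<dots> =
        (\<Sum>j'\<in>UNIV. \<Sum>\<sigma>'\<in>UNIV. (if \<sigma> = \<sigma>' then A $ j $ j' else 0) * (u \<sigma>' * x $ j'))"
      by (rule sum.cartesian_product[symmetric])
    also have "\<dots> = (\<Sum>j'\<in>UNIV. \<Sum>\<sigma>'\<in>UNIV. if \<sigma>' = \<sigma> then A $ j $ j' * (u \<sigma> * x $ j') else 0)"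
      by (intro sum.cong) auto
    also have "\<dots> = u \<sigma> * (\<Sum>j'\<in>UNIV. A $ j $ j' * x $ j')"
      by (simp add: sum_distrib_left mult_ac)
    finally show ?thesis .
  qed
  then show ?thesis
    by (simp add: vec_eq_iff tensor_def tensor_matrix_def matrix_vector_mult_def)
qed

text \<open>Every row is hit by the same Kronecker product of \<open>A\<close> with the identity,
  which amounts to one matrix factor. The character depends on \<open>'s\<close> but not on
  \<open>Bs\<close>, so products of equally many determinants have the same character.\<close>

lemma block_det_linear_map:
  fixes Bs :: "('a::field, 's::finite) blocks" and v :: "nat \<Rightarrow> nat \<Rightarrow> 'a ^ 'n"
  shows "block_det k Bs (\<lambda>q a. A *v v q a) =
    det (tensor_matrix A :: 'a ^ ('n \<times> 's) ^ ('n \<times> 's)) * block_det k Bs v"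
proof -
  let ?T = "tensor_matrix A :: 'a ^ ('n \<times> 's::finite) ^ ('n \<times> 's)"
  let ?M = "\<chi> \<rho>. block_row Bs v (row_label k Bs \<rho>) :: 'a ^ ('n \<times> 's) ^ ('n \<times> 's)"
  have "block_row Bs (\<lambda>q a. A *v v q a) \<rho> = ?T *v block_row Bs v \<rho>" for \<rho>
    by (simp add: block_row_def tensor_matrix_mult split: prod.split)
  then have "(\<chi> \<rho>. block_row Bs (\<lambda>q a. A *v v q a) (row_label k Bs \<rho>)) = ?M ** transpose ?T"
    by (simp add: vec_eq_iff matrix_matrix_mult_def matrix_vector_mult_def transpose_def mult.commute)
  then show ?thesis
    unfolding block_det_def by (simp add: det_mul mult.commute)
qed


section \<open>Semi-invariants and sparseness\<close>

text \<open>Here \<open>w (l, i)\<close> is thought of as a basis of the \<open>i\<close>-th member of the \<open>l\<close>-th flag.\<close>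

definition semi_invariant ::
    "nat \<Rightarrow> nat \<Rightarrow> (nat \<Rightarrow> nat) \<Rightarrow> (nat \<times> nat) multiset \<Rightarrow> ('a::field ^ 'n ^ 'n \<Rightarrow> 'a)
      \<Rightarrow> ((nat \<times> nat \<Rightarrow> nat \<Rightarrow> 'a ^ 'n) \<Rightarrow> 'a) \<Rightarrow> bool"
  where "semi_invariant m r k \<B> \<theta> F \<longleftrightarrow>
    (\<exists>P\<in>multidegree m r k \<B>. \<forall>w. F w = P (\<lambda>(l, i, J). pluecker_minor (w (l, i)) J)) \<and>
    (\<forall>w w' M. (\<forall>l\<in>{1..m}. \<forall>i\<in>{1..r}. \<forall>a<k i. w' (l, i) a = (\<Sum>b<k i. M (l, i) a b *s w (l, i) b)) \<longrightarrow>
      F w' = (\<Prod>p\<in>#\<B>. transition_det (k (snd p)) (M p)) * F w) \<and>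
    (\<forall>A w. F (\<lambda>p a. A *v w p a) = \<theta> A * F w)"

lemma semi_invariant_polynomial:
  assumes "semi_invariant m r k \<B> \<theta> F"
  obtains P where "P \<in> multidegree m r k \<B>" "\<And>w. F w = P (\<lambda>(l, i, J). pluecker_minor (w (l, i)) J)"
proof -
  obtain P where "P \<in> multidegree m r k \<B>" "\<forall>w. F w = P (\<lambda>(l, i, J). pluecker_minor (w (l, i)) J)"
    using assms[unfolded semi_invariant_def, THEN conjunct1] ..
  then show ?thesis
    by (intro that) blast+
qed

lemma semi_invariant_base_change:
  assumes "semi_invariant m r k \<B> \<theta> F"
    and "\<forall>l\<in>{1..m}. \<forall>i\<in>{1..r}. \<forall>a<k i. w' (l, i) a = (\<Sum>b<k i. M (l, i) a b *s w (l, i) b)"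
  shows "F w' = (\<Prod>p\<in>#\<B>. transition_det (k (snd p)) (M p)) * F w"
  by (rule assms(1)[unfolded semi_invariant_def, THEN conjunct2, THEN conjunct1, THEN spec, THEN spec,
      THEN spec, THEN mp, OF assms(2)])

lemma semi_invariant_linear_map:
  assumes "semi_invariant m r k \<B> \<theta> F"
  shows "F (\<lambda>p a. A *v w p a) = \<theta> A * F w"
  by (rule assms[unfolded semi_invariant_def, THEN conjunct2, THEN conjunct2, THEN spec, THEN spec])

lemma semi_invariant_one: "semi_invariant m r k {#} (\<lambda>A. 1) (\<lambda>w. 1)"
  unfolding semi_invariant_def using multidegree_const[of 1 m r k] by auto

lemma semi_invariant_mult:
  fixes F G :: "(nat \<times> nat \<Rightarrow> nat \<Rightarrow> 'a::field ^ 'n) \<Rightarrow> 'a"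
  assumes F: "semi_invariant m r k \<A> \<theta> F" and G: "semi_invariant m r k \<B> \<psi> G"
  shows "semi_invariant m r k (\<A> + \<B>) (\<lambda>A. \<theta> A * \<psi> A) (\<lambda>w. F w * G w)"
proof -
  obtain P where P: "P \<in> multidegree m r k \<A>" "\<And>w. F w = P (\<lambda>(l, i, J). pluecker_minor (w (l, i)) J)"
    using semi_invariant_polynomial[OF F] by blast
  obtain Q where Q: "Q \<in> multidegree m r k \<B>" "\<And>w. G w = Q (\<lambda>(l, i, J). pluecker_minor (w (l, i)) J)"
    using semi_invariant_polynomial[OF G] by blast
  show ?thesis
    unfolding semi_invariant_def
  proof (intro conjI allI impI)
    show "\<exists>R\<in>multidegree m r k (\<A> + \<B>). \<forall>w. F w * G w = R (\<lambda>(l, i, J). pluecker_minor (w (l, i)) J)"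
      by (rule bexI[OF _ multidegree_mult[OF P(1) Q(1)]]) (simp only: P(2) Q(2) simp_thms)
  next
    fix w w' :: "nat \<times> nat \<Rightarrow> nat \<Rightarrow> 'a ^ 'n" and M
    assume M: "\<forall>l\<in>{1..m}. \<forall>i\<in>{1..r}. \<forall>a<k i. w' (l, i) a = (\<Sum>b<k i. M (l, i) a b *s w (l, i) b)"
    show "F w' * G w' = (\<Prod>p\<in>#\<A> + \<B>. transition_det (k (snd p)) (M p)) * (F w * G w)"
      unfolding semi_invariant_base_change[OF F M] semi_invariant_base_change[OF G M] by (simp add: mult_ac)
  next
    fix A w
    show "F (\<lambda>p a. A *v w p a) * G (\<lambda>p a. A *v w p a) = \<theta> A * \<psi> A * (F w * G w)"
      unfolding semi_invariant_linear_map[OF F] semi_invariant_linear_map[OF G] by (simp add: mult_ac)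
  qed
qed

lemma semi_invariant_block_det:
  fixes Bs :: "('a::field, 's::finite) blocks"
  assumes "square TYPE('n::finite) k Bs" and sub: "set (map fst Bs) \<subseteq> {1..m} \<times> {1..r}"
    and "\<And>i. i \<in> {1..r} \<Longrightarrow> k i \<le> CARD('n)"
  shows "semi_invariant m r k (mset (map fst Bs))
    (\<lambda>A :: 'a ^ 'n ^ 'n. det (tensor_matrix A :: 'a ^ ('n \<times> 's) ^ ('n \<times> 's)))
    (\<lambda>w. block_det k Bs (\<lambda>q. w (fst (Bs ! q))))"
  unfolding semi_invariant_def
proof (intro conjI allI impI)
  show "\<exists>P\<in>multidegree m r k (mset (map fst Bs)). \<forall>w :: nat \<times> nat \<Rightarrow> nat \<Rightarrow> 'a ^ 'n.
      block_det k Bs (\<lambda>q. w (fst (Bs ! q))) = P (\<lambda>(l, i, J). pluecker_minor (w (l, i)) J)"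
    by (rule block_det_laplace[OF assms])
next
  fix w w' :: "nat \<times> nat \<Rightarrow> nat \<Rightarrow> 'a ^ 'n" and M
  assume "\<forall>l\<in>{1..m}. \<forall>i\<in>{1..r}. \<forall>a<k i. w' (l, i) a = (\<Sum>b<k i. M (l, i) a b *s w (l, i) b)"
  then show "block_det k Bs (\<lambda>q. w' (fst (Bs ! q))) =
      (\<Prod>p\<in>#mset (map fst Bs). transition_det (k (snd p)) (M p)) * block_det k Bs (\<lambda>q. w (fst (Bs ! q)))"
    using sub by (intro block_det_base_change[OF assms(1)]) blast
next
  fix A :: "'a ^ 'n ^ 'n" and w
  show "block_det k Bs (\<lambda>q a. A *v w (fst (Bs ! q)) a) =
      det (tensor_matrix A :: 'a ^ ('n \<times> 's) ^ ('n \<times> 's)) * block_det k Bs (\<lambda>q. w (fst (Bs ! q)))"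
    by (rule block_det_linear_map)
qed

section \<open>Independence of the chosen bases, and the sparseness criterion\<close>

lemma span_subspace_basis:
  assumes "vec.subspace U"
  shows "vec.span (subspace_basis U ` {..<vec.dim U}) = U"
proof -
  obtain S where S: "S \<subseteq> U" "vec.independent S" "U \<subseteq> vec.span S" "card S = vec.dim U"
    using vec.basis_exists by blast
  then obtain w where w: "bij_betw w {..<vec.dim U} S"
    using ex_bij_betw_nat_finite[OF vec.finiteI_independent[OF S(2)]] by (auto simp: atLeast0LessThan)
  have "vec.span S = U"
    using S(1,3) assms by (simp add: subset_antisym vec.span_minimal)
  then have "\<exists>w. inj_on w {..<vec.dim U} \<and> vec.independent (w ` {..<vec.dim U}) \<and>
      vec.span (w ` {..<vec.dim U}) = U"
    using w S(2) by (auto simp: bij_betw_def)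
  from someI_ex[OF this] show ?thesis
    by (simp add: subspace_basis_def)
qed

lemma in_span_range:
  fixes w :: "nat \<Rightarrow> 'a::field ^ 'n"
  assumes "x \<in> vec.span (w ` {..<d})"
  shows "\<exists>c. x = (\<Sum>b<d. c b *s w b)"
proof -
  let ?H = "range (\<lambda>c. \<Sum>b<d. c b *s w b)"
  have "vec.subspace ?H"
  proof (rule vec.subspaceI)
    show "0 \<in> ?H"
      by (rule range_eqI[of _ _ "\<lambda>_. 0"]) simp
  next
    fix x y assume "x \<in> ?H" "y \<in> ?H"
    then obtain c e where "x = (\<Sum>b<d. c b *s w b)" "y = (\<Sum>b<d. e b *s w b)"
      by auto
    then show "x + y \<in> ?H"
      by (intro range_eqI[of _ _ "\<lambda>b. c b + e b"]) (simp add: vec.scale_left_distrib sum.distrib)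
  next
    fix a x assume "x \<in> ?H"
    then obtain c where "x = (\<Sum>b<d. c b *s w b)"
      by auto
    then show "a *s x \<in> ?H"
      by (intro range_eqI[of _ _ "\<lambda>b. a * c b"]) (simp add: vec.scale_sum_right)
  qed
  moreover have "w ` {..<d} \<subseteq> ?H"
  proof clarify
    fix a assume "a < d"
    have "(\<Sum>b<d. (if b = a then 1 else 0) *s w b) = (\<Sum>b<d. if b = a then w b else 0)"
      by (intro sum.cong) auto
    also have "\<dots> = w a"
      using \<open>a < d\<close> by (simp add: sum.delta)
    finally have "w a = (\<Sum>b<d. (if b = a then 1 else 0) *s w b)"
      by simp
    then show "w a \<in> ?H"
      by (rule range_eqI[of _ _ "\<lambda>b. if b = a then 1 else 0"])
  qed
  ultimately show ?thesis
    using vec.span_minimal[of "w ` {..<d}" ?H] assms by auto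
qed

definition spanning_family ::
    "nat \<Rightarrow> nat \<Rightarrow> (nat \<Rightarrow> nat) \<Rightarrow> (nat \<Rightarrow> nat \<Rightarrow> ('a::field ^ 'n) set)
      \<Rightarrow> (nat \<times> nat \<Rightarrow> nat \<Rightarrow> 'a ^ 'n) \<Rightarrow> bool"
  where "spanning_family m r k x w \<longleftrightarrow>
    (\<forall>l\<in>{1..m}. \<forall>i\<in>{1..r}. vec.span (w (l, i) ` {..<k i}) = x l i)"

text \<open>The base change factor depends only on \<open>\<B>\<close> and on the transition
  matrices, so it is common to \<open>F\<close> and \<open>G\<close>.\<close>

lemma semi_invariant_ratio:
  assumes "semi_invariant m r k \<B> \<theta> F" "semi_invariant m r k \<B> \<theta> G"
    and "spanning_family m r k x w" "spanning_family m r k x w'"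
  shows "\<exists>\<kappa>. F w' = \<kappa> * F w \<and> G w' = \<kappa> * G w"
proof -
  have "\<forall>p a. \<exists>c. p \<in> {1..m} \<times> {1..r} \<and> a < k (snd p) \<longrightarrow> w' p a = (\<Sum>b<k (snd p). c b *s w p b)"
  proof (intro allI)
    fix p a
    have "w' p a \<in> vec.span (w p ` {..<k (snd p)})" if "p \<in> {1..m} \<times> {1..r}" "a < k (snd p)"
      using that assms(3,4) vec.span_base[of "w' p a" "w' p ` {..<k (snd p)}"]
      by (cases p) (auto simp: spanning_family_def)
    then show "\<exists>c. p \<in> {1..m} \<times> {1..r} \<and> a < k (snd p) \<longrightarrow> w' p a = (\<Sum>b<k (snd p). c b *s w p b)"
      using in_span_range by blast
  qed
  from choice[OF allI[OF choice[OF spec[OF this]]]] obtain M where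
    "\<forall>p a. p \<in> {1..m} \<times> {1..r} \<and> a < k (snd p) \<longrightarrow> w' p a = (\<Sum>b<k (snd p). M p a b *s w p b)" ..
  then have M: "\<forall>l\<in>{1..m}. \<forall>i\<in>{1..r}. \<forall>a<k i. w' (l, i) a = (\<Sum>b<k i. M (l, i) a b *s w (l, i) b)"
    by simp
  from semi_invariant_base_change[OF assms(1) M] semi_invariant_base_change[OF assms(2) M] show ?thesis
    by (intro exI conjI)
qed

text \<open>The class is \<open>{mat c ** A | c. c \<noteq> 0}\<close>, and the scalar can be moved
  onto the vector, where a subspace absorbs it.\<close>

lemma PGL_image_eq:
  assumes "C \<in> carrier (PGL :: ('a::field ^ 'n ^ 'n) set monoid)"
  obtains A where "\<And>U. vec.subspace U \<Longrightarrow> PGL_image C U = (\<lambda>v. A *v v) ` U"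
proof -
  obtain A where "C = r_coset GL scalar_matrices A"
    using assms unfolding PGL_def carrier_FactGroup by blast
  then have C: "C = {mat c ** A | c. c \<noteq> 0}"
    unfolding r_coset_def scalar_matrices_def GL_def monoid.simps by blast
  have "PGL_image C U = (\<lambda>v. A *v v) ` U" if "vec.subspace U" for U
  proof (rule antisym)
    have "(mat c ** A) *v v = A *v (c *s v)" for c v
      by (simp add: vec_eq_iff matrix_vector_mult_def mat_mult_left mult_ac)
    then show "PGL_image C U \<subseteq> (\<lambda>v. A *v v) ` U"
      using vec.subspace_scale[OF that] unfolding PGL_image_def C by auto
    have "A \<in> C"
      unfolding C mem_Collect_eq by (intro exI[of _ 1]) simp
    then show "(\<lambda>v. A *v v) ` U \<subseteq> PGL_image C U"
      unfolding PGL_image_def by blast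
  qed
  then show ?thesis
    by (rule that)
qed

lemma sparse_if_semi_invariants:
  fixes F G :: "(nat \<times> nat \<Rightarrow> nat \<Rightarrow> 'a::field ^ 'n) \<Rightarrow> 'a"
  assumes F: "semi_invariant m r k \<B> \<theta> F" and G: "semi_invariant m r k \<B> \<theta> G"
    and \<B>: "set_mset \<B> \<subseteq> {1..m} \<times> {1..r}"
    and y: "y \<in> flag_power m r k" "spanning_family m r k y w" "F w \<noteq> 0" "G w = 0"
    and y': "y' \<in> flag_power m r k" "spanning_family m r k y' w'" "G w' \<noteq> 0"
  shows "sparse_action TYPE('a) TYPE('n) m r k"
  unfolding sparse_action_def dense_action_def
proof clarify
  fix x :: "nat \<Rightarrow> nat \<Rightarrow> ('a ^ 'n) set"
  assume x: "x \<in> flag_power m r k"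
    and dense: "zariski m r k closure_of orbit PGL (diagonal_action m r) x = flag_power m r k"
  define b where "b z = (\<lambda>(l, i). subspace_basis (z l i))" for z :: "nat \<Rightarrow> nat \<Rightarrow> ('a ^ 'n) set"
  have flag: "vec.subspace (z l i) \<and> vec.dim (z l i) = k i"
    if "z \<in> flag_power m r k" "l \<in> {1..m}" "i \<in> {1..r}" for z :: "nat \<Rightarrow> nat \<Rightarrow> ('a ^ 'n) set" and l i
    using that by (auto simp: flag_power_def flags_def PiE_def Pi_def)
  have b: "spanning_family m r k z (b z)" if "z \<in> flag_power m r k" for z
    using flag[OF that] span_subspace_basis unfolding spanning_family_def b_def by fastforce
  obtain P where P: "P \<in> multidegree m r k \<B>" "\<And>w. F w = P (\<lambda>(l, i, J). pluecker_minor (w (l, i)) J)"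
    using semi_invariant_polynomial[OF F] by blast
  obtain Q where Q: "Q \<in> multidegree m r k \<B>" "\<And>w. G w = Q (\<lambda>(l, i, J). pluecker_minor (w (l, i)) J)"
    using semi_invariant_polynomial[OF G] by blast
  have coords: "P (pluecker_coords z) = F (b z)" "Q (pluecker_coords z) = G (b z)" for z
    unfolding P(2) Q(2) pluecker_coords_def b_def by (simp_all add: case_prod_unfold)
  \<comment> \<open>Both \<open>b z\<close> and the image of \<open>b x\<close> under a
    representative \<open>A\<close> span the flags of \<open>z\<close>; the factors from base change
    and from \<open>\<theta> A\<close> are shared by \<open>F\<close> and \<open>G\<close>.\<close>
  have orbit: "\<exists>\<kappa>. F (b z) = \<kappa> * F (b x) \<and> G (b z) = \<kappa> * G (b x)"
    if z: "z \<in> orbit PGL (diagonal_action m r) x" "z \<in> flag_power m r k" for z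
  proof -
    obtain C where C: "C \<in> carrier PGL" and z_eq: "z = diagonal_action m r C x"
      using z(1) unfolding orbit_def by auto
    obtain A where A: "\<And>U. vec.subspace U \<Longrightarrow> PGL_image C U = (\<lambda>v. A *v v) ` U"
      using PGL_image_eq[OF C] by blast
    have "vec.span ((\<lambda>a. A *v b x (l, i) a) ` {..<k i}) = z l i" if "l \<in> {1..m}" "i \<in> {1..r}" for l i
    proof -
      have "z l i = (\<lambda>v. A *v v) ` x l i"
        using that flag[OF x that] A by (simp add: z_eq diagonal_action_def)
      also have "x l i = vec.span (b x (l, i) ` {..<k i})"
        using b[OF x] that unfolding spanning_family_def by blast
      also have "(\<lambda>v. A *v v) ` \<dots> = vec.span ((\<lambda>v. A *v v) ` b x (l, i) ` {..<k i})"
        by (rule vec.linear_span_image[OF matrix_vector_mul_linear_gen, symmetric])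
      finally show ?thesis
        by (simp add: image_image)
    qed
    then have "spanning_family m r k z (\<lambda>p a. A *v b x p a)"
      unfolding spanning_family_def by blast
    from semi_invariant_ratio[OF F G this b[OF z(2)]] obtain \<kappa>
      where "F (b z) = \<kappa> * F (\<lambda>p a. A *v b x p a)" "G (b z) = \<kappa> * G (\<lambda>p a. A *v b x p a)"
      by blast
    then have "F (b z) = \<kappa> * \<theta> A * F (b x)" "G (b z) = \<kappa> * \<theta> A * G (b x)"
      by (simp_all only: semi_invariant_linear_map[OF F] semi_invariant_linear_map[OF G] mult.assoc)
    then show ?thesis
      by blast
  qed
  have everywhere: "s * F (b z) + t * G (b z) = 0"
    if x0: "s * F (b x) + t * G (b x) = 0" and z: "z \<in> flag_power m r k" for s t z
  proof -
    let ?R = "\<lambda>c. s * P c + t * Q c"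
    have "?R \<in> multihomogeneous m r k"
      by (rule multidegree_imp_multihomogeneous[OF multidegree_add[OF multidegree_scale multidegree_scale] \<B>])
        (rule P Q)+
    then have "closedin (zariski m r k) (zero_locus m r k {?R})"
      unfolding closedin_zariski by blast
    moreover have "flag_power m r k \<inter> orbit PGL (diagonal_action m r) x \<subseteq> zero_locus m r k {?R}"
    proof
      fix z assume z: "z \<in> flag_power m r k \<inter> orbit PGL (diagonal_action m r) x"
      then obtain \<kappa> where "F (b z) = \<kappa> * F (b x)" "G (b z) = \<kappa> * G (b x)"
        using orbit by blast
      then have "s * F (b z) + t * G (b z) = \<kappa> * (s * F (b x) + t * G (b x))"
        by (simp add: algebra_simps)
      with x0 z show "z \<in> zero_locus m r k {?R}"
        by (simp add: zero_locus_def coords)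
    qed
    \<comment> \<open>The closure sees only the part of the orbit inside the topspace; intersecting
      with it avoids a separate proof that the action preserves flags.\<close>
    ultimately have "zariski m r k closure_of (topspace (zariski m r k) \<inter> orbit PGL (diagonal_action m r) x)
        \<subseteq> zero_locus m r k {?R}"
      by (intro closure_of_minimal) (simp_all add: topspace_zariski)
    then have "flag_power m r k \<subseteq> zero_locus m r k {?R}"
      using dense by (simp add: closure_of_restrict[symmetric])
    then show ?thesis
      using z by (auto simp: zero_locus_def coords)
  qed
  \<comment> \<open>\<open>\<kappa>\<close> is not known to be nonzero, so the comparison is made in
    both directions: one transfers \<open>F w \<noteq> 0\<close> to \<open>b y\<close>, the other
    \<open>G w = 0\<close>.\<close>
  obtain \<kappa> where "F w = \<kappa> * F (b y)" "G (b y) = 0"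
    using semi_invariant_ratio[OF F G b[OF y(1)] y(2)] semi_invariant_ratio[OF F G y(2) b[OF y(1)]] y(4)
    by auto
  then have y0: "F (b y) \<noteq> 0" "G (b y) = 0"
    using y(3) by auto
  have y0': "G (b y') \<noteq> 0"
    using semi_invariant_ratio[OF F G b[OF y'(1)] y'(2)] y'(3) by auto
  \<comment> \<open>The combination with coefficients \<open>G (b x)\<close> and
    \<open>- F (b x)\<close> vanishes at \<open>x\<close> for trivial reasons. Its value at
    \<open>y\<close> forces \<open>G (b x) = 0\<close>, so \<open>G\<close> alone vanishes
    everywhere, contradicting \<open>y'\<close>.\<close>
  have "G (b x) * F (b y) + (- F (b x)) * G (b y) = 0"
    by (rule everywhere[OF _ y(1)]) (simp add: mult.commute)
  then have "0 * F (b x) + 1 * G (b x) = 0"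
    using y0 by simp
  from everywhere[OF this y'(1)] y0' show False
    by simp
qed

section \<open>Flags with prescribed spanning vectors\<close>

text \<open>The given vectors keep their positions at the front, because flag members will be spans
  of initial segments.\<close>

lemma extend_to_basis:
  fixes w :: "nat \<Rightarrow> 'a::field ^ 'n"
  assumes "inj_on w {..<N}" "vec.independent (w ` {..<N})"
  obtains b where "\<And>a. a < N \<Longrightarrow> b a = w a" "inj_on b {..<CARD('n)}" "vec.independent (b ` {..<CARD('n)})"
proof -
  let ?S = "w ` {..<N}"
  let ?T = "vec.extend_basis ?S"
  have T: "?S \<subseteq> ?T" "vec.independent ?T" "vec.span ?T = UNIV"
    using assms(2) by (simp_all add: vec.extend_basis_superset vec.independent_extend_basis)
  have fin: "finite ?T"
    using T(2) by (rule vec.finiteI_independent)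
  have "card ?T = CARD('n)"
    using vec.dim_span_eq_card_independent[OF T(2)] T(3) by (metis vec_dim_card)
  then have card: "card (?T - ?S) = CARD('n) - N" and N: "N \<le> CARD('n)"
    using T(1) fin assms(1) card_mono[OF fin T(1)] by (simp_all add: card_Diff_subset card_image)
  obtain h where h: "bij_betw h {..<card (?T - ?S)} (?T - ?S)"
    using ex_bij_betw_nat_finite[of "?T - ?S"] fin by (auto simp: atLeast0LessThan)
  define b where "b a = (if a < N then w a else h (a - N))" for a
  have "bij_betw (\<lambda>a. a - N) {N..<CARD('n)} {..<CARD('n) - N}"
    using N by (intro bij_betw_byWitness[where f' = "\<lambda>a. a + N"]) auto
  then have "bij_betw (h \<circ> (\<lambda>a. a - N)) {N..<CARD('n)} (?T - ?S)"
    using h card by (auto intro: bij_betw_trans)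
  then have "bij_betw b {N..<CARD('n)} (?T - ?S)"
    by (subst bij_betw_cong[where g = "h \<circ> (\<lambda>a. a - N)"]) (auto simp: b_def)
  moreover have "bij_betw b {..<N} ?S"
    using assms(1) by (subst bij_betw_cong[where g = w]) (auto simp: b_def bij_betw_def)
  ultimately have "bij_betw b ({..<N} \<union> {N..<CARD('n)}) (?S \<union> (?T - ?S))"
    by (intro bij_betw_combine) auto
  moreover have "{..<N} \<union> {N..<CARD('n)} = {..<CARD('n)}" "?S \<union> (?T - ?S) = ?T"
    using N T(1) by auto
  ultimately have "bij_betw b {..<CARD('n)} ?T"
    by simp
  then show ?thesis
    using T(2) by (intro that[of b]) (auto simp: b_def bij_betw_def)
qed

text \<open>Each flag consists of spans of initial segments of one full basis. Nesting is then
  automatic, and the members of the flag not governed by \<open>w\<close> are supplied by the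
  extension.\<close>

lemma flags_from_bases:
  fixes w :: "nat \<Rightarrow> nat \<Rightarrow> 'a::field ^ 'n"
  assumes ind: "\<And>l. l \<in> {1..m} \<Longrightarrow> inj_on (w l) {..<N l} \<and> vec.independent (w l ` {..<N l})"
    and mono: "strict_mono_on {1..r} k" and bound: "\<And>i. i \<in> {1..r} \<Longrightarrow> k i \<le> CARD('n)"
  obtains x :: "nat \<Rightarrow> nat \<Rightarrow> ('a ^ 'n) set" and b where "x \<in> flag_power m r k"
    "spanning_family m r k x (\<lambda>(l, i). b l)" "\<And>l a. l \<in> {1..m} \<Longrightarrow> a < N l \<Longrightarrow> b l a = w l a"
proof -
  have "\<forall>l\<in>{1..m}. \<exists>b. (\<forall>a<N l. b a = w l a) \<and> inj_on b {..<CARD('n)} \<and> vec.independent (b ` {..<CARD('n)})"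
    using ind extend_to_basis by metis
  then obtain b where b: "\<And>l. l \<in> {1..m} \<Longrightarrow>
      (\<forall>a<N l. b l a = w l a) \<and> inj_on (b l) {..<CARD('n)} \<and> vec.independent (b l ` {..<CARD('n)})"
    by metis
  define x where "x = (\<lambda>l\<in>{1..m}. \<lambda>i\<in>{1..r}. vec.span (b l ` {..<k i}))"
  have dim: "vec.dim (b l ` {..<k i}) = k i" if "l \<in> {1..m}" "i \<in> {1..r}" for l i
  proof -
    have sub: "{..<k i} \<subseteq> {..<CARD('n)}"
      using bound[OF that(2)] by auto
    then have "vec.independent (b l ` {..<k i})"
      using b[OF that(1)] by (meson vec.independent_mono image_mono)
    moreover have "card (b l ` {..<k i}) = k i"
      using inj_on_subset[OF _ sub, of "b l"] b[OF that(1)] by (simp add: card_image)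
    ultimately show ?thesis
      by (simp add: vec.dim_eq_card_independent)
  qed
  have sub: "vec.span (b l ` {..<k i}) \<subseteq> vec.span (b l ` {..<k j})" if "i \<in> {1..r}" "j \<in> {1..r}" "i < j" for l i j
    using strict_mono_onD[OF mono that] by (intro vec.span_mono image_mono) auto
  have "x \<in> flag_power m r k"
    unfolding flag_power_def flags_def using dim sub by (auto simp: x_def)
  moreover have "spanning_family m r k x (\<lambda>(l, i). b l)"
    by (simp add: spanning_family_def x_def)
  ultimately show ?thesis
    using that b by blast
qed


lemma semi_invariant_prod_list:
  fixes Bss :: "('a::field, 's::finite) blocks list"
  assumes "\<And>Bs. Bs \<in> set Bss \<Longrightarrow> square TYPE('n::finite) k Bs"
    and "set (map fst (concat Bss)) \<subseteq> {1..m} \<times> {1..r}"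
    and k: "\<And>i. i \<in> {1..r} \<Longrightarrow> k i \<le> CARD('n)"
  shows "semi_invariant m r k (mset (map fst (concat Bss)))
    (\<lambda>A :: 'a ^ 'n ^ 'n. det (tensor_matrix A :: 'a ^ ('n \<times> 's) ^ ('n \<times> 's)) ^ length Bss)
    (\<lambda>w. prod_list (map (\<lambda>Bs. block_det k Bs (\<lambda>q. w (fst (Bs ! q)))) Bss))"
  using assms(1,2)
proof (induction Bss)
  case Nil
  show ?case by (simp add: semi_invariant_one)
next
  case (Cons Bs Bss)
  have "semi_invariant m r k (mset (map fst Bs) + mset (map fst (concat Bss)))
    (\<lambda>A :: 'a ^ 'n ^ 'n. det (tensor_matrix A :: 'a ^ ('n \<times> 's) ^ ('n \<times> 's)) *
      det (tensor_matrix A :: 'a ^ ('n \<times> 's) ^ ('n \<times> 's)) ^ length Bss)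
    (\<lambda>w. block_det k Bs (\<lambda>q. w (fst (Bs ! q))) *
      prod_list (map (\<lambda>Bs. block_det k Bs (\<lambda>q. w (fst (Bs ! q)))) Bss))"
    using Cons.prems by (intro semi_invariant_mult semi_invariant_block_det Cons.IH k) auto
  then show ?case by simp
qed

text \<open>All members of flag \<open>l\<close> use initial segments of the same sequence
  \<open>w l\<close>, so only the flag index of a block selects vectors.\<close>

abbreviation flag_det :: "(nat \<Rightarrow> nat) \<Rightarrow> (nat \<Rightarrow> nat \<Rightarrow> 'a::field ^ 'n) \<Rightarrow> ('a, 's::finite) blocks \<Rightarrow> 'a"
  where "flag_det k w Bs \<equiv> block_det k Bs (\<lambda>q. w (fst (fst (Bs ! q))))"

text \<open>A nonzero determinant forces the rows of each of its blocks to be independent. Hence the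
  longest initial segment of \<open>w l\<close> in use extends to a basis, and no row of the
  determinants changes.\<close>

lemma flags_from_block_dets:
  fixes w :: "nat \<Rightarrow> nat \<Rightarrow> 'a::field ^ 'n" and Bss :: "('a, 's::finite) blocks list"
  assumes square: "\<And>Bs. Bs \<in> set Bss \<Longrightarrow> square TYPE('n) k Bs"
    and nz: "\<And>Bs. Bs \<in> set Bss \<Longrightarrow> flag_det k w Bs \<noteq> 0"
    and mono: "strict_mono_on {1..r} k" and bound: "\<And>i. i \<in> {1..r} \<Longrightarrow> k i \<le> CARD('n)"
  obtains x :: "nat \<Rightarrow> nat \<Rightarrow> ('a ^ 'n) set" and b where "x \<in> flag_power m r k"
    "spanning_family m r k x (\<lambda>(l, i). b l)"
    "\<And>Bs :: ('a, 's) blocks. square TYPE('n) k Bs \<Longrightarrow> set (map fst Bs) \<subseteq> set (map fst (concat Bss)) \<Longrightarrow>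
      set (map fst Bs) \<subseteq> {1..m} \<times> {1..r} \<Longrightarrow> flag_det k b Bs = flag_det k w Bs"
proof -
  define K where "K l = {k i | i. (l, i) \<in> set (map fst (concat Bss))}" for l
  \<comment> \<open>Inserting 0 covers flags that occur in no block.\<close>
  define N where "N l = Max (insert 0 (K l))" for l
  have "K l = (\<lambda>(l, i). k i) ` {p \<in> set (map fst (concat Bss)). fst p = l}" for l
    unfolding K_def by force
  then have fin: "finite (K l)" for l
    by simp
  have ind: "inj_on (w l) {..<N l} \<and> vec.independent (w l ` {..<N l})" for l
  proof (cases "N l = 0")
    case True
    then show ?thesis by (simp add: vec.independent_empty)
  next
    case False
    have "N l \<in> insert 0 (K l)"
      unfolding N_def using fin by (intro Max_in) auto
    with False obtain i Bs where i: "N l = k i" "Bs \<in> set Bss" "(l, i) \<in> set (map fst Bs)"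
      unfolding K_def by auto
    then obtain q where q: "q < length Bs" "fst (Bs ! q) = (l, i)"
      by (auto simp: in_set_conv_nth)
    then show ?thesis
      using block_det_nonzero_imp_independent[OF square[OF i(2)] nz[OF i(2)] q(1)] i(1) by simp
  qed
  obtain x :: "nat \<Rightarrow> nat \<Rightarrow> ('a ^ 'n) set" and b where x: "x \<in> flag_power m r k"
      "spanning_family m r k x (\<lambda>(l, i). b l)"
    and b: "\<And>l a. l \<in> {1..m} \<Longrightarrow> a < N l \<Longrightarrow> b l a = w l a"
    using flags_from_bases[of m w N r k] ind mono bound by blast
  have "flag_det k b Bs = flag_det k w Bs"
    if "square TYPE('n) k Bs" "set (map fst Bs) \<subseteq> set (map fst (concat Bss))"
      "set (map fst Bs) \<subseteq> {1..m} \<times> {1..r}" for Bs :: "('a, 's) blocks"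
  proof (rule block_det_local[OF that(1)])
    fix q a assume q: "q < length Bs" "a < block_size k Bs q"
    obtain l i where li: "fst (Bs ! q) = (l, i)"
      by fastforce
    then have mem: "(l, i) \<in> set (map fst Bs)"
      using q(1) by (metis length_map nth_map nth_mem)
    then have "k i \<in> K l"
      using that(2) unfolding K_def by blast
    then have "k i \<le> N l"
      unfolding N_def using fin by (intro Max_ge) auto
    then show "b (fst (fst (Bs ! q))) a = w (fst (fst (Bs ! q))) a"
      using q(2) li mem that(3) by (intro b) auto
  qed
  with x show ?thesis
    using that by blast
qed

text \<open>Take the products over \<open>Bss\<close> and \<open>Css\<close> as \<open>F\<close> and
  \<open>G\<close>: equal label multisets give equal multidegree, and equal lengths give equal
  character.\<close>

lemma sparse_if_block_dets:
  fixes w w' :: "nat \<Rightarrow> nat \<Rightarrow> 'a::field ^ 'n" and Bss Css :: "('a, 's::finite) blocks list"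
  assumes square: "\<And>Bs. Bs \<in> set Bss \<union> set Css \<Longrightarrow> square TYPE('n) k Bs"
    and sub: "set (map fst (concat Bss)) \<subseteq> {1..m} \<times> {1..r}"
    and same: "mset (map fst (concat Bss)) = mset (map fst (concat Css))" "length Bss = length Css"
    and w: "\<And>Bs. Bs \<in> set Bss \<Longrightarrow> flag_det k w Bs \<noteq> 0" "Cs \<in> set Css" "flag_det k w Cs = 0"
    and w': "\<And>Cs. Cs \<in> set Css \<Longrightarrow> flag_det k w' Cs \<noteq> 0"
    and mono: "strict_mono_on {1..r} k" and bound: "\<And>i. i \<in> {1..r} \<Longrightarrow> k i \<le> CARD('n)"
  shows "sparse_action TYPE('a) TYPE('n) m r k"
proof -
  let ?F = "\<lambda>Bss w. prod_list (map (\<lambda>Bs. block_det k Bs (\<lambda>q. w (fst (Bs ! q)))) Bss)"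
  have set_eq: "set (map fst (concat Bss)) = set (map fst (concat Css))"
    using same(1) by (metis set_mset_mset)
  have labels: "set (map fst Bs) \<subseteq> set (map fst (concat Bss))" if "Bs \<in> set Bss \<union> set Css" for Bs
    using that unfolding Un_iff
  proof
    assume "Bs \<in> set Css"
    then show ?thesis unfolding set_eq by auto
  qed auto
  obtain x :: "nat \<Rightarrow> nat \<Rightarrow> ('a ^ 'n) set" and b where x: "x \<in> flag_power m r k"
      "spanning_family m r k x (\<lambda>(l, i). b l)"
    and b: "\<And>Bs :: ('a, 's) blocks. square TYPE('n) k Bs \<Longrightarrow> set (map fst Bs) \<subseteq> set (map fst (concat Bss)) \<Longrightarrow>
      set (map fst Bs) \<subseteq> {1..m} \<times> {1..r} \<Longrightarrow> flag_det k b Bs = flag_det k w Bs"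
    using flags_from_block_dets[of Bss k w r m] square w(1) mono bound by blast
  obtain x' :: "nat \<Rightarrow> nat \<Rightarrow> ('a ^ 'n) set" and b' where x': "x' \<in> flag_power m r k"
      "spanning_family m r k x' (\<lambda>(l, i). b' l)"
    and b': "\<And>Bs :: ('a, 's) blocks. square TYPE('n) k Bs \<Longrightarrow> set (map fst Bs) \<subseteq> set (map fst (concat Css)) \<Longrightarrow>
      set (map fst Bs) \<subseteq> {1..m} \<times> {1..r} \<Longrightarrow> flag_det k b' Bs = flag_det k w' Bs"
    using flags_from_block_dets[of Css k w' r m] square w' mono bound by blast
  have F_flag: "?F Bss (\<lambda>(l, i). b l) = prod_list (map (flag_det k b) Bss)"
    for Bss :: "('a, 's) blocks list" and b :: "nat \<Rightarrow> nat \<Rightarrow> 'a ^ 'n"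
    by (simp add: case_prod_unfold)
  have dets: "flag_det k b Bs = flag_det k w Bs" "flag_det k b' Bs = flag_det k w' Bs"
    if "Bs \<in> set Bss \<union> set Css" for Bs
    using b[OF square[OF that] labels[OF that]] b'[OF square[OF that] labels[OF that, unfolded set_eq]]
      labels[OF that] sub by auto
  show ?thesis
  proof (rule sparse_if_semi_invariants[OF _ _ _ x _ _ x'])
    show "semi_invariant m r k (mset (map fst (concat Bss)))
        (\<lambda>A :: 'a ^ 'n ^ 'n. det (tensor_matrix A :: 'a ^ ('n \<times> 's) ^ ('n \<times> 's)) ^ length Bss) (?F Bss)"
      using square sub bound by (intro semi_invariant_prod_list) auto
    show "semi_invariant m r k (mset (map fst (concat Bss)))
        (\<lambda>A :: 'a ^ 'n ^ 'n. det (tensor_matrix A :: 'a ^ ('n \<times> 's) ^ ('n \<times> 's)) ^ length Bss) (?F Css)"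
      unfolding same using square sub[unfolded set_eq] bound by (intro semi_invariant_prod_list) auto
    show "set_mset (mset (map fst (concat Bss))) \<subseteq> {1..m} \<times> {1..r}"
      using sub by simp
    show "?F Bss (\<lambda>(l, i). b l) \<noteq> 0" "?F Css (\<lambda>(l, i). b l) = 0" "?F Css (\<lambda>(l, i). b' l) \<noteq> 0"
      unfolding F_flag prod_list_zero_iff using dets w w' by (force simp: image_iff)+
  qed
qed

lemma square_iff:
  fixes Bs :: "('a, 's::finite) blocks"
  shows "square TYPE('n::finite) k Bs \<longleftrightarrow>
    (\<Sum>B\<leftarrow>Bs. k (snd (fst B))) = CARD('n) * CARD('s)"
  by (simp add: square_def sum_list_sum_nth atLeast0LessThan)

lemma flag_det_nonzero:
  fixes w :: "nat \<Rightarrow> nat \<Rightarrow> 'a::field ^ 'n" and Bs :: "('a, 's::finite) blocks"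
  assumes "square TYPE('n) k Bs"
    and span: "\<And>H. vec.subspace H \<Longrightarrow> (\<And>l i u a. ((l, i), u) \<in> set Bs \<Longrightarrow> a < k i \<Longrightarrow> tensor u (w l a) \<in> H) \<Longrightarrow>
      H = UNIV"
  shows "flag_det k w Bs \<noteq> 0"
proof (rule block_det_nonzero[OF assms(1)])
  fix H :: "('a ^ ('n \<times> 's)) set"
  assume H: "vec.subspace H" "\<And>q a. q < length Bs \<Longrightarrow> a < block_size k Bs q \<Longrightarrow>
    tensor (snd (Bs ! q)) (w (fst (fst (Bs ! q))) a) \<in> H"
  show "H = UNIV"
  proof (rule span[OF H(1)])
    fix l i u a assume "((l, i), u) \<in> set Bs" "a < k i"
    then obtain q where "q < length Bs" "Bs ! q = ((l, i), u)"
      by (auto simp: in_set_conv_nth)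
    then show "tensor u (w l a) \<in> H"
      using H(2)[of q a] \<open>a < k i\<close> by simp
  qed
qed

lemma subspace_tensor_vimage:
  fixes u :: "'s::finite \<Rightarrow> 'a::field" and H :: "('a ^ ('n::finite \<times> 's)) set"
  assumes "vec.subspace H"
  shows "vec.subspace {x. tensor u x \<in> H}"
proof -
  have "tensor u (0 :: 'a ^ 'n) = 0"
    by (simp add: tensor_def vec_eq_iff)
  then show ?thesis
    using assms by (auto simp: vec.subspace_def tensor_add tensor_scale)
qed

lemma tensor_span:
  fixes H :: "('a::field ^ ('n::finite \<times> 's::finite)) set"
  assumes "vec.subspace H" and "\<And>\<sigma> x. tensor (\<lambda>\<tau>. if \<tau> = \<sigma> then 1 else 0) x \<in> H"
  shows "H = UNIV"
proof -
  have "z \<in> H" for z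
  proof -
    have sum: "(\<Sum>\<sigma>\<in>UNIV. tensor (\<lambda>\<tau>. if \<tau> = \<sigma> then 1 else 0) (\<chi> j. z $ (j, \<sigma>))) = z"
      by (simp add: vec_eq_iff tensor_def if_distrib[of "\<lambda>x. x * _"] cong: if_cong)
    have "(\<Sum>\<sigma>\<in>UNIV. tensor (\<lambda>\<tau>. if \<tau> = \<sigma> then 1 else 0) (\<chi> j. z $ (j, \<sigma>))) \<in> H"
      by (intro vec.subspace_sum[OF assms(1)] assms(2))
    then show ?thesis
      unfolding sum .
  qed
  then show ?thesis by auto
qed

text \<open>The standard basis, recorded only through its spanning property in the form used by the
  determinant criterion.\<close>

lemma obtain_basis_sequence:
  obtains e :: "nat \<Rightarrow> 'a::field ^ 'n"
  where "\<And>H. vec.subspace H \<Longrightarrow> (\<And>p. p < CARD('n) \<Longrightarrow> e p \<in> H) \<Longrightarrow> H = UNIV"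
proof -
  obtain \<nu> :: "nat \<Rightarrow> 'n" where \<nu>: "bij_betw \<nu> {..<CARD('n)} UNIV"
    using ex_bij_betw_nat_finite[of "UNIV :: 'n set"] by (auto simp: atLeast0LessThan)
  show ?thesis
  proof (rule that[of "\<lambda>p. axis (\<nu> p) 1"])
    fix H :: "('a ^ 'n) set"
    assume H: "vec.subspace H" "\<And>p. p < CARD('n) \<Longrightarrow> axis (\<nu> p) 1 \<in> H"
    have "x \<in> H" for x
    proof -
      have "axis j 1 \<in> H" for j
      proof -
        have "j \<in> \<nu> ` {..<CARD('n)}"
          using \<nu> by (simp add: bij_betw_def)
        then show ?thesis
          using H(2) by blast
      qed
      then have "(\<Sum>j\<in>UNIV. x $ j *s axis j 1) \<in> H"
        by (intro vec.subspace_sum[OF H(1)] vec.subspace_scale[OF H(1)])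
      then show ?thesis
        unfolding basis_expansion .
    qed
    then show "H = UNIV" by auto
  qed
qed


section \<open>Configurations of flags\<close>

text \<open>With \<open>e\<close> a basis and \<open>p\<close> fixed, these vectors for \<open>l \<in> {1..t + 2}\<close> are linearly independent if
  \<open>ext p\<close> provides a further basis vector, and otherwise \<open>t + 2\<close> general vectors of a space of dimension
  \<open>t + 1\<close>. The configurations are direct sums of such blocks. Coordinate subspaces alone would not do:
  the smallest members must be in general position, but \<open>n\<close> can be too small for all of them to be
  independent.\<close>

definition block_vector :: "(nat \<Rightarrow> 'a::field ^ 'n) \<Rightarrow> nat \<Rightarrow> (nat \<Rightarrow> nat option) \<Rightarrow> nat \<Rightarrow> nat \<Rightarrow> 'a ^ 'n"
  where "block_vector e t ext p l =
    (if l \<le> t + 1 then e (p * (t + 1) + (l - 1))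
     else case ext p of Some q \<Rightarrow> e q | None \<Rightarrow> (\<Sum>l'\<in>{1..t + 1}. e (p * (t + 1) + (l' - 1))))"

text \<open>The last vector is the sum of the other \<open>t + 1\<close>, so each of the
  \<open>t + 2\<close> vectors is a combination of the rest with coefficients 1 and -1.\<close>

lemma block_vector_dependent:
  assumes "vec.subspace H" "ext p = None" "z \<in> {1..t + 2}"
    and H: "\<And>l. l \<in> {1..t + 2} \<Longrightarrow> l \<noteq> z \<Longrightarrow> block_vector e t ext p l \<in> H"
  shows "block_vector e t ext p z \<in> H"
proof -
  let ?v = "block_vector e t ext p"
  have sum: "?v (t + 2) = (\<Sum>l\<in>{1..t + 1}. ?v l)"
    using assms(2) by (simp add: block_vector_def)
  show ?thesis
  proof (cases "z = t + 2")
    case True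
    then show ?thesis
      unfolding True sum using H[unfolded True] by (intro vec.subspace_sum[OF assms(1)]) auto
  next
    case False
    then have z: "z \<in> {1..t + 1}"
      using assms(3) by auto
    have "?v z = ?v (t + 2) - (\<Sum>l\<in>{1..t + 1} - {z}. ?v l)"
      unfolding sum sum.remove[OF finite_atLeastAtMost z] by simp
    moreover have "(\<Sum>l\<in>{1..t + 1} - {z}. ?v l) \<in> H"
      using H by (intro vec.subspace_sum[OF assms(1)]) auto
    moreover have "?v (t + 2) \<in> H"
      using False by (intro H) auto
    ultimately show ?thesis
      using vec.subspace_diff[OF assms(1)] by metis
  qed
qed

lemma block_vector_basis:
  assumes "q < a * (t + 1)"
  obtains p l where "p < a" "l \<in> {1..t + 1}" "e q = block_vector e t ext p l"
proof (rule that[of "q div (t + 1)" "q mod (t + 1) + 1"])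
  show "q div (t + 1) < a"
    using assms by (simp add: less_mult_imp_div_less)
  have "q mod (t + 1) < t + 1"
    by simp
  then show "q mod (t + 1) + 1 \<in> {1..t + 1}"
    by auto
  then show "e q = block_vector e t ext (q div (t + 1)) (q mod (t + 1) + 1)"
    unfolding block_vector_def by (simp only: atLeastAtMost_iff if_True add_diff_cancel_right' div_mult_mod_eq)
qed

section \<open>Sparseness for two members with \<open>k j = n - t * k i\<close>\<close>

text \<open>The first flag type: \<open>v p l\<close> for \<open>p < a\<close> spans the smaller member of the \<open>l\<close>-th flag, and the larger
  one contains in addition \<open>v 0 (s l)\<close> and basis vectors common to all flags.\<close>

definition first_configuration ::
    "(nat \<Rightarrow> 'a::field ^ 'n) \<Rightarrow> nat \<Rightarrow> nat \<Rightarrow> (nat \<Rightarrow> nat) \<Rightarrow> nat \<Rightarrow> nat \<Rightarrow> 'a ^ 'n"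
  where "first_configuration e t a s l c =
    (let v = block_vector e t (\<lambda>p. if p = 0 then Some (a * (t + 1)) else None)
     in if c < a then v c l else if c = a then v 0 (s l) else e (a * (t + 1) + (c - a)))"

text \<open>The list \<open>[4..<t + 3]\<close> holds the \<open>t - 1\<close> fixed flags; flags 1,
  2, 3 are left for the triple ratio.\<close>

definition first_blocks :: "nat \<Rightarrow> nat \<Rightarrow> nat \<Rightarrow> nat \<Rightarrow> nat \<Rightarrow> ('a::field, unit) blocks"
  where "first_blocks i j t x y =
    map (\<lambda>l. ((l, i), \<lambda>_. 1)) [4..<t + 3] @ [((x, i), \<lambda>_. 1), ((y, j), \<lambda>_. 1)]"

lemma square_first_blocks:
  assumes "t \<ge> 1" "CARD('n::finite) = t * k i + k j"
  shows "square TYPE('n) k (first_blocks i j t x y)"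
proof -
  obtain t' where "t = Suc t'"
    using assms(1) by (cases t) auto
  with assms show ?thesis
    by (simp add: square_iff first_blocks_def o_def sum_list_triv)
qed

text \<open>The rows contain \<open>v p l\<close> for all flags \<open>l\<close> except
  \<open>z\<close>. For \<open>p = 0\<close> the missing \<open>v 0 z\<close> is the additional
  vector in the larger member of flag \<open>y\<close>, as \<open>s y = z\<close>; for
  \<open>p > 0\<close> it follows from the linear relation.\<close>

lemma first_configuration_nonzero:
  fixes e :: "nat \<Rightarrow> 'a::field ^ 'n"
  assumes e: "\<And>H. vec.subspace H \<Longrightarrow> (\<And>p. p < CARD('n) \<Longrightarrow> e p \<in> H) \<Longrightarrow> H = UNIV"
    and t: "t \<ge> 1" and n: "CARD('n) = t * k i + k j" and k: "0 < k i" "k i < k j"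
    and xyz: "{x, y, z} = {1, 2, 3}" "s y = z"
  shows "flag_det k (first_configuration e t (k i) s) (first_blocks i j t x y) \<noteq> 0"
proof (rule flag_det_nonzero[OF square_first_blocks[where 'n = 'n and k = k and i = i and j = j, OF t n]])
  let ?w = "first_configuration e t (k i) s"
  define ext :: "nat \<Rightarrow> nat option" where "ext = (\<lambda>p. if p = 0 then Some (k i * (t + 1)) else None)"
  let ?v = "block_vector e t ext"
  have w: "?w l c = (if c < k i then ?v c l else if c = k i then ?v 0 (s l) else e (k i * (t + 1) + (c - k i)))" for l c
    by (simp add: first_configuration_def ext_def Let_def)
  fix H :: "('a ^ ('n \<times> unit)) set"
  assume H: "vec.subspace H"
    and rows: "\<And>l i' u a. ((l, i'), u) \<in> set (first_blocks i j t x y) \<Longrightarrow> a < k i' \<Longrightarrow> tensor u (?w l a) \<in> H"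
  define K where "K = {x. tensor (\<lambda>_. 1) x \<in> H}"
  have K: "vec.subspace K"
    unfolding K_def by (rule subspace_tensor_vimage[OF H])
  have T: "?w l c \<in> K" if "l \<in> {4..<t + 3}" "c < k i" for l c
    using rows[of l i "\<lambda>_. 1" c] that by (auto simp: first_blocks_def K_def)
  have X: "?w x c \<in> K" if "c < k i" for c
    using rows[of x i "\<lambda>_. 1" c] that by (auto simp: first_blocks_def K_def)
  have Y: "?w y c \<in> K" if "c < k j" for c
    using rows[of y j "\<lambda>_. 1" c] that by (auto simp: first_blocks_def K_def)
  have others: "?v p l \<in> K" if "p < k i" "l \<in> {1..t + 2}" "l \<noteq> z" for p l
  proof -
    have "l \<in> {4..<t + 3} \<or> l \<in> {1, 2, 3}"
      using that(2) by auto
    then have "l \<in> {4..<t + 3} \<or> l = x \<or> l = y"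
      unfolding xyz(1)[symmetric] using that(3) by auto
    then show ?thesis
      using T[of l p] X[of p] Y[of p] that(1) k by (auto simp: w)
  qed
  have z: "?v p z \<in> K" if "p < k i" for p
  proof (cases "p = 0")
    case True
    then show ?thesis
      using Y[of "k i"] k xyz(2) by (simp add: w)
  next
    case False
    have "z \<in> {1, 2, 3}"
      unfolding xyz(1)[symmetric] by simp
    then have z_range: "z \<in> {1..t + 2}"
      using t by auto
    have "ext p = None"
      using False by (simp add: ext_def)
    then show ?thesis
      by (rule block_vector_dependent[where ext = ext, OF K _ z_range]) (rule others[OF that]; assumption)
  qed
  have v: "?v p l \<in> K" if "p < k i" "l \<in> {1..t + 2}" for p l
    using others[OF that] z[OF that(1)] by (cases "l = z") simp_all
  have "K = UNIV"
  proof (rule e[OF K])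
    fix q assume q: "q < CARD('n)"
    consider "q < k i * (t + 1)" | "q = k i * (t + 1)" | "q > k i * (t + 1)"
      by linarith
    then show "e q \<in> K"
    proof cases
      case 1
      then obtain p l where "p < k i" "l \<in> {1..t + 1}" "e q = ?v p l"
        by (rule block_vector_basis)
      then show ?thesis
        using v[of p l] by auto
    next
      case 2
      then show ?thesis
        using v[of 0 "t + 2"] k by (simp add: block_vector_def ext_def)
    next
      case 3
      \<comment> \<open>Inverts the index \<open>k i * (t + 1) + (c - k i)\<close> of the common
        basis vectors.\<close>
      define c where "c = q - k i * t"
      have c: "q = k i * (t + 1) + (c - k i)" "k i < c" "c < k j"
        using 3 q n by (auto simp: c_def mult.commute)
      then show ?thesis
        using Y[of c] by (simp add: w)
    qed
  qed
  then have "tensor (\<lambda>_. 1) x \<in> H" for x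
    unfolding K_def by blast
  then show "H = UNIV"
    by (intro tensor_span[OF H]) simp
qed

text \<open>With \<open>s y = x\<close> the vector \<open>v 0 x\<close> appears twice: as row 0 of
  the block of \<open>x\<close> and as row \<open>k i\<close> of the block of
  \<open>y\<close>.\<close>

lemma first_configuration_zero:
  fixes e :: "nat \<Rightarrow> 'a::field ^ 'n"
  assumes t: "t \<ge> 1" and n: "CARD('n) = t * k i + k j" and k: "0 < k i" "k i < k j" and "s y = x"
  shows "flag_det k (first_configuration e t (k i) s) (first_blocks i j t x y) = 0"
proof (rule block_det_identical_rows[OF square_first_blocks[where 'n = 'n and k = k and i = i and j = j, OF t n]])
  let ?B = "first_blocks i j t x y :: ('a, unit) blocks"
  have len: "length [4..<t + 3] = t - 1"
    by simp
  show "t - 1 < length ?B" "t < length ?B"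
    using t by (simp_all add: first_blocks_def)
  have x: "?B ! (t - 1) = ((x, i), \<lambda>_. 1)" and y: "?B ! t = ((y, j), \<lambda>_. 1)"
    using t by (cases t; simp add: first_blocks_def nth_append del: upt_Suc)+
  show "0 < block_size k ?B (t - 1)" "k i < block_size k ?B t" "(t - 1, 0) \<noteq> (t, k i)"
    using k t x y by simp_all
  show "block_row ?B (\<lambda>q. first_configuration e t (k i) s (fst (fst (?B ! q)))) (t - 1, 0) =
      block_row ?B (\<lambda>q. first_configuration e t (k i) s (fst (fst (?B ! q)))) (t, k i)"
    using x y k \<open>s y = x\<close> by (simp add: block_row_def first_configuration_def)
qed

text \<open>The two orientations of the cycle 1, 2, 3. Taking \<open>s = rot\<close> keeps the
  numerator nonzero and kills the denominator; \<open>s = unrot\<close> keeps the denominator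
  nonzero.\<close>

definition rot :: "nat \<Rightarrow> nat" where "rot l = (if l = 1 then 2 else if l = 2 then 3 else 1)"
definition unrot :: "nat \<Rightarrow> nat" where "unrot l = (if l = 1 then 3 else if l = 2 then 1 else 2)"

lemma first_sparse:
  fixes k :: "nat \<Rightarrow> nat"
  assumes mono: "strict_mono_on {1..r} k" and bounds: "\<forall>i\<in>{1..r}. 0 < k i \<and> k i < CARD('n::finite)"
    and ij: "1 \<le> i" "i < j" "j \<le> r" and t: "t \<ge> 1" and n: "CARD('n) = t * k i + k j"
    and m: "t + 2 \<le> m"
  shows "sparse_action TYPE('a::field) TYPE('n) m r k"
proof -
  obtain e :: "nat \<Rightarrow> 'a ^ 'n" where
    e: "\<And>H. vec.subspace H \<Longrightarrow> (\<And>p. p < CARD('n) \<Longrightarrow> e p \<in> H) \<Longrightarrow> H = UNIV"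
    using obtain_basis_sequence[where 'a = 'a and 'n = 'n] by blast
  have k: "0 < k i" "k i < k j"
    using bounds ij strict_mono_onD[OF mono, of i j] by auto
  let ?D = "first_blocks i j t :: nat \<Rightarrow> nat \<Rightarrow> ('a, unit) blocks"
  let ?w = "first_configuration e t (k i)"
  note nonzero = first_configuration_nonzero[where k = k and i = i and j = j, OF e t n k]
  show ?thesis
  proof (rule sparse_if_block_dets[where Bss = "[?D 1 2, ?D 2 3, ?D 3 1]" and
        Css = "[?D 1 3, ?D 3 2, ?D 2 1]" and w = "?w rot" and w' = "?w unrot" and Cs = "?D 1 3"])
    show "square TYPE('n) k Bs" if "Bs \<in> set [?D 1 2, ?D 2 3, ?D 3 1] \<union> set [?D 1 3, ?D 3 2, ?D 2 1]" for Bs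
      using that square_first_blocks[where 'n = 'n and k = k and i = i and j = j, OF t n] by auto
    show "set (map fst (concat [?D 1 2, ?D 2 3, ?D 3 1])) \<subseteq> {1..m} \<times> {1..r}"
      using ij t m by (auto simp: first_blocks_def)
    \<comment> \<open>In either product each of the flags 1, 2, 3 contributes both of its members
      once, and every fixed flag occurs three times.\<close>
    show "mset (map fst (concat [?D 1 2, ?D 2 3, ?D 3 1])) = mset (map fst (concat [?D 1 3, ?D 3 2, ?D 2 1]))"
      by (simp add: first_blocks_def)
    show "flag_det k (?w rot) Bs \<noteq> 0" if "Bs \<in> set [?D 1 2, ?D 2 3, ?D 3 1]" for Bs
      using that nonzero[where x = 1 and y = 2 and z = 3 and s = rot] nonzero[where x = 2 and y = 3 and z = 1 and s = rot] nonzero[where x = 3 and y = 1 and z = 2 and s = rot] by (auto simp: rot_def)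
    show "flag_det k (?w unrot) Bs \<noteq> 0" if "Bs \<in> set [?D 1 3, ?D 3 2, ?D 2 1]" for Bs
      using that nonzero[where x = 1 and y = 3 and z = 2 and s = unrot] nonzero[where x = 3 and y = 2 and z = 1 and s = unrot] nonzero[where x = 2 and y = 1 and z = 3 and s = unrot] by (auto simp: unrot_def)
    show "flag_det k (?w rot) (?D 1 3) = 0"
      by (rule first_configuration_zero[where k = k and i = i and j = j, OF t n k]) (simp add: rot_def)
    show "length [?D 1 2, ?D 2 3, ?D 3 1] = length [?D 1 3, ?D 3 2, ?D 2 1]" "?D 1 3 \<in> set [?D 1 3, ?D 3 2, ?D 2 1]"
      by simp_all
    show "k i' \<le> CARD('n)" if "i' \<in> {1..r}" for i'
      using bounds that less_imp_le by blast
  qed (rule mono)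
qed

section \<open>Sparseness for three members with \<open>2 * k h + k i + k j = 2 * n\<close>\<close>

text \<open>The second flag type: \<open>v p l\<close> for \<open>p < a\<close> spans the smallest member of the \<open>l\<close>-th flag, the
  middle one contains in addition \<open>v 0 (s l)\<close> and basis vectors common to all flags, and the largest
  one contains moreover all \<open>v p\<close> with \<open>p \<ge> a - d\<close>.\<close>

definition second_ext :: "nat \<Rightarrow> nat \<Rightarrow> nat \<Rightarrow> nat option"
  where "second_ext a d p =
    (if p = 0 then Some (2 * a) else if a - d \<le> p then Some (2 * a + 1 + (p - (a - d))) else None)"

definition second_configuration ::
    "(nat \<Rightarrow> 'a::field ^ 'n) \<Rightarrow> nat \<Rightarrow> nat \<Rightarrow> nat \<Rightarrow> (nat \<Rightarrow> nat) \<Rightarrow> nat \<Rightarrow> nat \<Rightarrow> 'a ^ 'n"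
  where "second_configuration e a b d s l c =
    (let v = block_vector e 1 (second_ext a d)
     in if c < a then v c l else if c = a then v 0 (s l) else if c < b then e (a + d + c)
        else if c < b + d then v (a - d + (c - b)) (s l) else v (a - d + (c - b - d)) (s (s l)))"

text \<open>The determinant of these blocks vanishes iff \<open>A\<^sub>x\<close>, \<open>B\<^sub>y\<close> and \<open>A\<^sub>z \<inter> C\<^sub>x\<close> are not in general
  position, where \<open>A \<subseteq> B \<subseteq> C\<close> are the members \<open>h\<close>, \<open>i\<close>, \<open>j\<close>.\<close>

definition second_blocks :: "nat \<Rightarrow> nat \<Rightarrow> nat \<Rightarrow> nat \<Rightarrow> nat \<Rightarrow> nat \<Rightarrow> ('a::field, bool) blocks"
  where "second_blocks h i j x y z =
    [((x, h), \<lambda>\<tau>. if \<tau> = False then 1 else 0), ((y, i), \<lambda>\<tau>. if \<tau> = False then 1 else 0),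
     ((z, h), \<lambda>_. 1), ((x, j), \<lambda>\<tau>. if \<tau> = True then 1 else 0)]"

lemma square_second_blocks:
  assumes "2 * k h + k i + k j = 2 * CARD('n::finite)"
  shows "square TYPE('n) k (second_blocks h i j x y z)"
  using assms by (simp add: square_iff second_blocks_def)

text \<open>\<open>K False\<close> and \<open>K True\<close> are the traces of \<open>H\<close> on
  the two copies of V, and the diagonal block moves vectors of the smallest member of flag
  \<open>z\<close> between them. Each \<open>v p l\<close> is reached in both copies through an
  added vector, the linear relation, or this exchange.\<close>

lemma second_configuration_nonzero:
  fixes e :: "nat \<Rightarrow> 'a::field ^ 'n"
  assumes e: "\<And>H. vec.subspace H \<Longrightarrow> (\<And>p. p < CARD('n) \<Longrightarrow> e p \<in> H) \<Longrightarrow> H = UNIV"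
    and n: "CARD('n) = k h + k i + d" "k j = k i + 2 * d" and k: "0 < k h" "k h < k i" "d < k h"
    and xyz: "{x, y, z} = {1, 2, 3}" "s x = y" "s y = z"
  shows "flag_det k (second_configuration e (k h) (k i) d s) (second_blocks h i j x y z) \<noteq> 0"
proof (rule flag_det_nonzero)
  show "square TYPE('n) k (second_blocks h i j x y z :: ('a, bool) blocks)"
    using n by (intro square_second_blocks) simp
  let ?w = "second_configuration e (k h) (k i) d s"
  let ?v = "block_vector e 1 (second_ext (k h) d)"
  let ?u = "\<lambda>\<sigma> \<tau> :: bool. if \<tau> = \<sigma> then 1 else 0 :: 'a"
  note w = second_configuration_def[of e "k h" "k i" d s, unfolded Let_def]
  fix H :: "('a ^ ('n \<times> bool)) set"
  assume H: "vec.subspace H"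
    and rows: "\<And>l i' u a. ((l, i'), u) \<in> set (second_blocks h i j x y z) \<Longrightarrow> a < k i' \<Longrightarrow> tensor u (?w l a) \<in> H"
  define K where "K \<sigma> = {x. tensor (?u \<sigma>) x \<in> H}" for \<sigma>
  have K: "vec.subspace (K \<sigma>)" for \<sigma>
    unfolding K_def by (rule subspace_tensor_vimage[OF H])
  have diag: "v \<in> K False \<longleftrightarrow> v \<in> K True" if "tensor (\<lambda>_. 1) v \<in> H" for v
  proof -
    have "tensor (\<lambda>_. 1) v = tensor (?u False) v + tensor (?u True) v"
      by (auto simp: tensor_def vec_eq_iff)
    with that show ?thesis
      unfolding K_def mem_Collect_eq
      by (metis H add_diff_cancel_left' add_diff_cancel_right' vec.subspace_diff)
  qed
  have X: "?w x c \<in> K False" if "c < k h" for c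
    using rows[of x h "?u False" c] that by (simp add: second_blocks_def K_def)
  have Y: "?w y c \<in> K False" if "c < k i" for c
    using rows[of y i "?u False" c] that by (simp add: second_blocks_def K_def)
  have Z: "?w z c \<in> K False \<longleftrightarrow> ?w z c \<in> K True" if "c < k h" for c
    using rows[of z h "\<lambda>_. 1" c] that by (intro diag) (simp add: second_blocks_def)
  have X': "?w x c \<in> K True" if "c < k j" for c
    using rows[of x j "?u True" c] that by (simp add: second_blocks_def K_def)
  have cyc: "l = x \<or> l = y \<or> l = z" if "l \<in> {1..3}" for l
  proof -
    have "l \<in> {1, 2, 3}"
      using that by auto
    then show ?thesis
      unfolding xyz(1)[symmetric] by simp
  qed
  have range: "x \<in> {1..3}" "y \<in> {1..3}" "z \<in> {1..3}"
  proof -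
    have "{x, y, z} \<subseteq> {1..3}"
      unfolding xyz(1) by simp
    then show "x \<in> {1..3}" "y \<in> {1..3}" "z \<in> {1..3}"
      by simp_all
  qed
  have xF: "?v p x \<in> K False" if "p < k h" for p
    using X[of p] that by (simp add: w)
  have yF: "?v p y \<in> K False" if "p < k h" for p
    using Y[of p] that k by (simp add: w)
  have zFT: "?v p z \<in> K False \<longleftrightarrow> ?v p z \<in> K True" if "p < k h" for p
    using Z[of p] that by (simp add: w)
  have xT: "?v p x \<in> K True" if "p < k h" for p
    using X'[of p] that k n by (simp add: w)
  \<comment> \<open>The largest member of flag \<open>x\<close> contains these vectors, since
    \<open>s x = y\<close> and \<open>s (s x) = z\<close>.\<close>
  have top: "?v p y \<in> K True \<and> ?v p z \<in> K True" if "p < k h" "k h - d \<le> p" for p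
  proof -
    define q where "q = p - (k h - d)"
    have q: "q < d" "p = k h - d + q"
      using that k by (auto simp: q_def)
    have "?w x (k i + q) = ?v p y" "?w x (k i + d + q) = ?v p z"
      using q(1) k(2) by (simp_all add: w q(2) xyz(2,3))
    moreover have "k i + q < k j" "k i + d + q < k j"
      using q(1) n(2) by simp_all
    ultimately show ?thesis
      using X' by metis
  qed
  have third: "?v p z' \<in> K \<sigma>" if "second_ext (k h) d p = None" "z' \<in> {1..3}"
    "\<And>l. l \<in> {x, y, z} \<Longrightarrow> l \<noteq> z' \<Longrightarrow> ?v p l \<in> K \<sigma>" for p z' \<sigma>
  proof (rule block_vector_dependent[where ext = "second_ext (k h) d", OF K that(1)])
    show "z' \<in> {1..1 + 2}"
      using that(2) by simp
    fix l assume "l \<in> {1..1 + 2}" "l \<noteq> z'"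
    then show "?v p l \<in> K \<sigma>"
      using cyc[of l] by (intro that(3)) auto
  qed
  \<comment> \<open>\<open>p = 0\<close> uses the vector added to the middle member of flag
    \<open>y\<close>; a triple with a relation uses \<open>x\<close> and \<open>y\<close>; for large
    \<open>p\<close> the vector is in the second copy by \<open>top\<close> and crosses
    over.\<close>
  have zF: "?v p z \<in> K False" if p: "p < k h" for p
  proof -
    consider "p = 0" | "second_ext (k h) d p = None" | "k h - d \<le> p"
      unfolding second_ext_def by fastforce
    then show ?thesis
    proof cases
      case 1
      then show ?thesis
        using Y[of "k h"] k xyz by (simp add: w)
    next
      case 2
      then show ?thesis
        using xF[OF p] yF[OF p] by (intro third[OF 2 range(3)]) auto
    next
      case 3
      then show ?thesis
        using zFT[OF p] top[OF p] by simp
    qed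
  qed
  have zT: "?v p z \<in> K True" if "p < k h" for p
    using zFT[OF that] zF[OF that] by simp
  have yT: "?v p y \<in> K True" if p: "p < k h" for p
  proof -
    consider "p = 0" | "second_ext (k h) d p = None" | "k h - d \<le> p"
      unfolding second_ext_def by fastforce
    then show ?thesis
    proof cases
      case 1
      then show ?thesis
        using X'[of "k h"] k n xyz by (simp add: w)
    next
      case 2
      then show ?thesis
        using xT[OF p] zT[OF p] by (intro third[OF 2 range(2)]) auto
    next
      case 3
      then show ?thesis
        using top[OF p] by simp
    qed
  qed
  have v: "?v p l \<in> K \<sigma>" if "p < k h" "l \<in> {1..3}" for p l \<sigma>
    using cyc[OF that(2)] xF yF zF xT yT zT that(1) by (cases \<sigma>) auto
  have common: "e (k h + d + c) \<in> K \<sigma>" if "k h < c" "c < k i" for c \<sigma>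
    using X'[of c] Y[of c] that n by (cases \<sigma>) (simp_all add: w)
  have "K \<sigma> = UNIV" for \<sigma>
  proof (rule e[OF K])
    fix q assume q: "q < CARD('n)"
    \<comment> \<open>The basis is laid out as \<open>2 * k h\<close> vectors for the flags 1 and 2,
      one extra vector for \<open>p = 0\<close>, \<open>d\<close> extra vectors for the last indices
      \<open>p\<close>, and then the common vectors.\<close>
    consider "q < k h * 2" | "q = k h * 2" | "k h * 2 < q" "q \<le> k h * 2 + d" | "k h * 2 + d < q"
      by linarith
    then show "e q \<in> K \<sigma>"
    proof cases
      case 1
      then have "q < k h * (1 + 1)"
        by simp
      then obtain p l where "p < k h" "l \<in> {1..1 + 1}" "e q = ?v p l"
        by (rule block_vector_basis)
      then show ?thesis
        using v[of p l] by auto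
    next
      case 2
      then show ?thesis
        using v[of 0 3 \<sigma>] k by (simp add: block_vector_def second_ext_def mult.commute)
    next
      case 3
      define p where "p = k h - d + (q - k h * 2 - 1)"
      have "p < k h" "p \<noteq> 0" "k h - d \<le> p" "2 * k h + 1 + (p - (k h - d)) = q"
        using 3 k by (auto simp: p_def)
      then show ?thesis
        using v[of p 3 \<sigma>] by (simp add: block_vector_def second_ext_def)
    next
      case 4
      define c where "c = q - k h - d"
      have "k h < c" "c < k i" "q = k h + d + c"
        using 4 q n by (auto simp: c_def)
      then show ?thesis
        using common[of c \<sigma>] by simp
    qed
  qed
  then show "H = UNIV"
    unfolding K_def by (intro tensor_span[OF H]) blast
qed

text \<open>With \<open>s y = x\<close> the vector \<open>v 0 x\<close> occurs in the first copy
  both as row 0 of the first block and as row \<open>k h\<close> of the second.\<close>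

lemma second_configuration_zero:
  fixes e :: "nat \<Rightarrow> 'a::field ^ 'n"
  assumes n: "2 * k h + k i + k j = 2 * CARD('n)" and k: "0 < k h" "k h < k i" and "s y = x"
  shows "flag_det k (second_configuration e (k h) (k i) d s) (second_blocks h i j x y z) = 0"
proof (rule block_det_identical_rows[OF square_second_blocks[where 'n = 'n and k = k and h = h and i = i and j = j, OF n]])
  let ?B = "second_blocks h i j x y z :: ('a, bool) blocks"
  show "0 < length ?B" "1 < length ?B" "0 < block_size k ?B 0" "k h < block_size k ?B 1" "(0, 0) \<noteq> (1 :: nat, k h)"
    using k by (simp_all add: second_blocks_def)
  show "block_row ?B (\<lambda>q. second_configuration e (k h) (k i) d s (fst (fst (?B ! q)))) (0, 0) =
      block_row ?B (\<lambda>q. second_configuration e (k h) (k i) d s (fst (fst (?B ! q)))) (1, k h)"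
    using k \<open>s y = x\<close> by (simp add: block_row_def second_configuration_def second_blocks_def)
qed

lemma second_sparse:
  fixes k :: "nat \<Rightarrow> nat"
  assumes mono: "strict_mono_on {1..r} k" and bounds: "\<forall>i\<in>{1..r}. 0 < k i \<and> k i < CARD('n::finite)"
    and hij: "1 \<le> h" "h < i" "i < j" "j \<le> r" and n: "2 * k h + k i + k j = 2 * CARD('n)"
  shows "sparse_action TYPE('a::field) TYPE('n) 3 r k"
proof -
  obtain e :: "nat \<Rightarrow> 'a ^ 'n" where
    e: "\<And>H. vec.subspace H \<Longrightarrow> (\<And>p. p < CARD('n) \<Longrightarrow> e p \<in> H) \<Longrightarrow> H = UNIV"
    using obtain_basis_sequence[where 'a = 'a and 'n = 'n] by blast
  have k: "0 < k h" "k h < k i" "k i < k j" "k j < CARD('n)"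
    using bounds hij strict_mono_onD[OF mono, of h i] strict_mono_onD[OF mono, of i j] by auto
  \<comment> \<open>This is half of \<open>k j - k i\<close>, so the subtraction does not truncate;
    \<open>k j < CARD('n)\<close> amounts to \<open>d < k h\<close>.\<close>
  define d where "d = CARD('n) - k h - k i"
  have d: "CARD('n) = k h + k i + d" "k j = k i + 2 * d" "d < k h"
    using k n by (auto simp: d_def)
  let ?E = "second_blocks h i j :: nat \<Rightarrow> nat \<Rightarrow> nat \<Rightarrow> ('a, bool) blocks"
  let ?w = "second_configuration e (k h) (k i) d"
  note nonzero = second_configuration_nonzero[where k = k and h = h and i = i and j = j, OF e d(1,2) k(1,2) d(3)]
  show ?thesis
  proof (rule sparse_if_block_dets[where Bss = "[?E 1 2 3, ?E 2 3 1, ?E 3 1 2]" and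
        Css = "[?E 1 3 2, ?E 3 2 1, ?E 2 1 3]" and w = "?w rot" and w' = "?w unrot" and Cs = "?E 1 3 2"])
    show "square TYPE('n) k Bs" if "Bs \<in> set [?E 1 2 3, ?E 2 3 1, ?E 3 1 2] \<union> set [?E 1 3 2, ?E 3 2 1, ?E 2 1 3]" for Bs
      using that square_second_blocks[where 'n = 'n and k = k and h = h and i = i and j = j, OF n] by auto
    show "set (map fst (concat [?E 1 2 3, ?E 2 3 1, ?E 3 1 2])) \<subseteq> {1..3} \<times> {1..r}"
      using hij by (auto simp: second_blocks_def)
    \<comment> \<open>In either product each flag contributes its smallest member twice and the
      other two members once.\<close>
    show "mset (map fst (concat [?E 1 2 3, ?E 2 3 1, ?E 3 1 2])) =
        mset (map fst (concat [?E 1 3 2, ?E 3 2 1, ?E 2 1 3]))"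
      by (simp add: second_blocks_def)
    show "flag_det k (?w rot) Bs \<noteq> 0" if "Bs \<in> set [?E 1 2 3, ?E 2 3 1, ?E 3 1 2]" for Bs
      using that nonzero[where x = 1 and y = 2 and z = 3 and s = rot] nonzero[where x = 2 and y = 3 and z = 1 and s = rot] nonzero[where x = 3 and y = 1 and z = 2 and s = rot] by (auto simp: rot_def)
    show "flag_det k (?w unrot) Bs \<noteq> 0" if "Bs \<in> set [?E 1 3 2, ?E 3 2 1, ?E 2 1 3]" for Bs
      using that nonzero[where x = 1 and y = 3 and z = 2 and s = unrot] nonzero[where x = 3 and y = 2 and z = 1 and s = unrot] nonzero[where x = 2 and y = 1 and z = 3 and s = unrot] by (auto simp: unrot_def)
    show "flag_det k (?w rot) (?E 1 3 2) = 0"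
      by (rule second_configuration_zero[where k = k and h = h and i = i and j = j, OF n k(1,2)]) (simp add: rot_def)
    show "length [?E 1 2 3, ?E 2 3 1, ?E 3 1 2] = length [?E 1 3 2, ?E 3 2 1, ?E 2 1 3]" "?E 1 3 2 \<in> set [?E 1 3 2, ?E 3 2 1, ?E 2 1 3]"
      by simp_all
    show "k i' \<le> CARD('n)" if "i' \<in> {1..r}" for i'
      using bounds that less_imp_le by blast
  qed (rule mono)
qed

theorem mainTheorem4:
  fixes n r :: nat and k :: "nat \<Rightarrow> nat"
  assumes dim_V: "CARD('n::finite) = n"
    and k_increasing: "strict_mono_on {1..r} k"
    and k_bounds: "\<forall>i\<in>{1..r}. 0 < k i \<and> k i < n"
  shows "(\<forall>m\<ge>1. (\<exists>i j t. 1 \<le> i \<and> i < j \<and> j \<le> r \<and> 1 \<le> t \<and>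
                    int (k j) = int n - int t * int (k i) \<and> max 4 (t + 2) \<le> m)
            \<longrightarrow> sparse_action TYPE('a::alg_closed_field) TYPE('n) m r k)
       \<and> ((\<exists>h i j. 1 \<le> h \<and> h < i \<and> i < j \<and> j \<le> r \<and> 2 * k h + k i + k j = 2 * n)
            \<longrightarrow> sparse_action TYPE('a) TYPE('n) 3 r k)"
proof (intro conjI allI impI)
  fix m
  assume "\<exists>i j t. 1 \<le> i \<and> i < j \<and> j \<le> r \<and> 1 \<le> t \<and>
    int (k j) = int n - int t * int (k i) \<and> max 4 (t + 2) \<le> m"
  then obtain i j t where ij: "1 \<le> i" "i < j" "j \<le> r" "1 \<le> t"
    and k: "int (k j) = int n - int t * int (k i)" and m: "max 4 (t + 2) \<le> m"
    by blast
  have "int n = int (t * k i + k j)"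
    using k by simp
  then have "CARD('n) = t * k i + k j"
    using dim_V by linarith
  moreover have "t + 2 \<le> m"
    using m by simp
  ultimately show "sparse_action TYPE('a) TYPE('n) m r k"
    by (rule first_sparse[OF k_increasing k_bounds[folded dim_V] ij])
next
  assume "\<exists>h i j. 1 \<le> h \<and> h < i \<and> i < j \<and> j \<le> r \<and> 2 * k h + k i + k j = 2 * n"
  then obtain h i j where hij: "1 \<le> h" "h < i" "i < j" "j \<le> r"
    and hn: "2 * k h + k i + k j = 2 * CARD('n)"
    unfolding dim_V by blast
  show "sparse_action TYPE('a) TYPE('n) 3 r k"
    by (rule second_sparse[OF k_increasing k_bounds[folded dim_V] hij hn])
qed

end
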